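(* Let $f:\mathbb{R}^d\to\mathbb{R}$ be continuously differentiable with Lipschitz continuous gradient with constant $L_1>0$, i.e. $\|\nabla f(z_1)-\nabla f(z_2)\|_*\le L_1\|z_1-z_2\|$ for all $z_1,z_2\in\mathbb{R}^d$. Let $\mu>0$ and let $\sigma\ge 0$ satisfy $E_u[\|G_\mu(z;u)-F_\mu(z)\|_*^2]\le\sigma^2$ for all $z\in\mathbb{R}^d$. Suppose that for some $\rho\in[0,\frac{1}{8L_1\kappa^2})$ there is $z^*\in\mathbb{R}^d$ such that $$\langle F(z),z-z^*\rangle+\frac{\rho}{2}\|F(z)\|_*^2\ge 0\quad\text{for all } z\in\mathbb{R}^d.$$ Let $\{z_k\}_{k\ge0}$, $\{\hat z_k\}_{k\ge0}$ be generated by the variance-reduced zeroth-order extragradient algorithm (unconstrained) with sample sizes $t_k\in\mathbb{N}$, $t_k\ge1$, and constant step sizes $h_1,h_2>0$ satisfying $$h_1\le\frac{1}{L_1\overline{\lambda}\kappa},\qquad h_2\in\left(\sqrt{\frac{2\rho}{L_1\overline{\lambda}\underline{\lambda}\kappa}},\frac{h_1}{2}\right].$$ Then for every number of iterations $N\ge 0$, $$\frac{1}{N+1}\sum_{k=0}^{N}E_{\mathcal{U}_k}[|F_\mu(\hat z_k)|^2]\le \frac{2\overline{\lambda}\underline{\lambda}L_1\kappa|z_0-z^*|^2}{(\overline{\lambda}\underline{\lambda}L_1\kappa h_2^2-2\rho)(N+1)}+\frac{2\underline{\lambda}\mu^2L_1 d}{\overline{\lambda}\underline{\lambda}L_1\kappa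 h_2^2-2\rho}+\frac{2\underline{\lambda}\mu^2L_1^2\rho(d+3)^3}{\overline{\lambda}\underline{\lambda}L_1\kappa h_2^2-2\rho}+\frac{3\underline{\lambda}\sigma^2}{L_1\kappa(\overline{\lambda}\underline{\lambda}L_1\kappa h_2^2-2\rho)}\cdot\frac{1}{N+1}\sum_{k=0}^{N}\frac{1}{t_k}.$$
   Context: $n,m\in\mathbb{N}$, $d=n+m$, points $z=(x,y)\in\mathbb{R}^n\times\mathbb{R}^m=\mathbb{R}^d$. $B_1\in\mathbb{R}^{n\times n}$, $B_2\in\mathbb{R}^{m\times m}$ are symmetric positive definite, $B$ is the block-diagonal matrix with blocks $B_1,B_2$; $\underline{\lambda}$, $\overline{\lambda}$ are its smallest and largest eigenvalues and $\kappa=\overline{\lambda}/\underline{\lambda}$. $\langle\cdot,\cdot\rangle$ is the Euclidean inner product, $|z|=\langle z,z\rangle^{1/2}$, $\|z\|=\langle z,Bz\rangle^{1/2}$, $\|z\|_*=\langle z,B^{-1}z\rangle^{1/2}$. $F(z)=(\nabla_x f(z),-\nabla_y f(z))$. For $\mu>0$ the Gaussian smoothing of $f$ is $f_\mu(z)=E_u[f(z+\mu u)]$ with $u\sim\mathcal{N}(0,B^{-1})$, and $F_\mu(z)=(\nabla_x f_\mu(z),-\nabla_y f_\mu(z))$. For $u=(u_1,u_2)\in\mathbb{R}^n\times\mathbb{R}^m$ the random oracle is $G_\mu(z;u)=\frac{f(z+\mu u)-f(z)}{\mu}\,(B_1u_1,-B_2u_2)$. Variance-reduced ZO-EG (unconstrained):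 given $z_0\in\mathbb{R}^d$, for $k=0,1,\dots,N$: sample $\hat u_k^1,\dots,\hat u_k^{t_k}\sim\mathcal{N}(0,B^{-1})$ and set $\hat z_k=z_k-h_1\frac{1}{t_k}\sum_{i=1}^{t_k}G_\mu(z_k;\hat u_k^i)$; sample $u_k^1,\dots,u_k^{t_k}\sim\mathcal{N}(0,B^{-1})$ and set $z_{k+1}=z_k-h_2\frac{1}{t_k}\sum_{i=1}^{t_k}G_\mu(\hat z_k;u_k^i)$. All sampled vectors are independent. $\mathcal{U}_k=[(u_0,\hat u_0),\dots,(u_k,\hat u_k)]$, where $u_j,\hat u_j$ denote the batches sampled at iteration $j$, and $E_{\mathcal{U}_k}$ is expectation over $\mathcal{U}_k$. *)

theory Defs
  imports "HOL-Probability.Probability"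
begin

definition spd :: "real^'n^'n \<Rightarrow> bool" where
  "spd A \<longleftrightarrow> transpose A = A \<and> (\<forall>x. x \<noteq> 0 \<longrightarrow> 0 < x \<bullet> (A *v x))"

text \<open>The space of \<open>z = (x, y)\<close> is the product type \<open>real^'n \<times> real^'m\<close>, whose inner product and
  norm are the Euclidean ones; a block-diagonal matrix is given by its two blocks and acts blockwise.\<close>

definition bdiag :: "real^'n^'n \<Rightarrow> real^'m^'m \<Rightarrow> (real^'n) \<times> (real^'m) \<Rightarrow> (real^'n) \<times> (real^'m)" where
  "bdiag A C z = (A *v fst z, C *v snd z)"

definition bdiag_eigenvalues :: "real^'n^'n \<Rightarrow> real^'m^'m \<Rightarrow> real set" where
  "bdiag_eigenvalues A C = {l. \<exists>v. v \<noteq> 0 \<and> bdiag A C v = l *\<^sub>R v}"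

definition normB :: "real^'n^'n \<Rightarrow> real^'m^'m \<Rightarrow> (real^'n) \<times> (real^'m) \<Rightarrow> real" where
  "normB B1 B2 z = sqrt (z \<bullet> bdiag B1 B2 z)"

definition normB_dual :: "real^'n^'n \<Rightarrow> real^'m^'m \<Rightarrow> (real^'n) \<times> (real^'m) \<Rightarrow> real" where
  "normB_dual B1 B2 z = sqrt (z \<bullet> bdiag (matrix_inv B1) (matrix_inv B2) z)"

definition grad :: "('a::real_inner \<Rightarrow> real) \<Rightarrow> 'a \<Rightarrow> 'a" where
  "grad f z = (THE g. GDERIV f z :> g)"

lemma grad_eq:
  assumes "GDERIV f z :> g"
  shows "grad f z = g"
  unfolding grad_def
proof (rule the_equality)
  fix g' assume "GDERIV f z :> g'"
  then have "(\<lambda>h. h \<bullet> g') = (\<lambda>h. h \<bullet> g)"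
    using assms has_derivative_unique unfolding gderiv_def by blast
  then have "(g' - g) \<bullet> g' = (g' - g) \<bullet> g"
    by meson
  then have "(g' - g) \<bullet> (g' - g) = 0"
    by (simp add: inner_diff_right)
  then show "g' = g"
    by simp
qed (rule assms)

text \<open>The operator \<open>(\<nabla>\<^sub>x f, -\<nabla>\<^sub>y f)\<close>, with partial gradients.\<close>

definition saddle_op :: "((real^'n) \<times> (real^'m) \<Rightarrow> real) \<Rightarrow> (real^'n) \<times> (real^'m) \<Rightarrow> (real^'n) \<times> (real^'m)" where
  "saddle_op f z =
     (grad (\<lambda>x. f (x, snd z)) (fst z), - grad (\<lambda>y. f (fst z, y)) (snd z))"

text \<open>The normal distribution with mean \<open>0\<close> and covariance \<open>B\<inverse>\<close>, where \<open>B\<close> has the blocks \<open>B1\<close>, \<open>B2\<close>;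
  \<open>det B1 * det B2\<close> is the determinant of \<open>B\<close>.\<close>

definition gaussian :: "real^'n^'n \<Rightarrow> real^'m^'m \<Rightarrow> ((real^'n) \<times> (real^'m)) measure" where
  "gaussian B1 B2 = density lborel (\<lambda>u. ennreal
     (sqrt (det B1 * det B2 / (2 * pi) ^ (CARD('n) + CARD('m))) * exp (- (u \<bullet> bdiag B1 B2 u) / 2)))"

definition gsmooth :: "real^'n^'n \<Rightarrow> real^'m^'m \<Rightarrow> real \<Rightarrow> ((real^'n) \<times> (real^'m) \<Rightarrow> real) \<Rightarrow>
    (real^'n) \<times> (real^'m) \<Rightarrow> real" where
  "gsmooth B1 B2 \<mu> f z = (\<integral>u. f (z + \<mu> *\<^sub>R u) \<partial>gaussian B1 B2)"

definition zo_oracle :: "real^'n^'n \<Rightarrow> real^'m^'m \<Rightarrow> real \<Rightarrow> ((real^'n) \<times> (real^'m) \<Rightarrow> real) \<Rightarrow>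
    (real^'n) \<times> (real^'m) \<Rightarrow> (real^'n) \<times> (real^'m) \<Rightarrow> (real^'n) \<times> (real^'m)" where
  "zo_oracle B1 B2 \<mu> f z u =
     ((f (z + \<mu> *\<^sub>R u) - f z) / \<mu>) *\<^sub>R (B1 *v fst u, - (B2 *v snd u))"

end

theory Submission
  imports Defs
begin

text \<open>Fix one iteration and write \<open>F\<close> for the operator of the smoothed function, \<open>e\<close> and \<open>e'\<close> for the
  errors of the two batch means, \<open>y = z - h1 (F z + e)\<close> for the half step and \<open>z' = z - h2 (F y + e')\<close>
  for the full step. Since \<open>F\<close> is Lipschitz with constant \<open>L1 * lmax \<le> 1 / h1\<close>, polarisation of
  \<open>2 (F y \<bullet> F z)\<close> yields
  \<open>2 (F y \<bullet> (F z + e)) \<ge> |F y|\<^sup>2 + 2 ((F (z - h1 F z) - F z) \<bullet> e) - 3 |e|\<^sup>2\<close>, whose middle term has mean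
  \<open>0\<close>. Averaging the weak Minty inequality at \<open>z + \<mu> u\<close> over \<open>u\<close> gives a weak Minty inequality for the
  smoothed operator up to an error of order \<open>\<mu>\<^sup>2\<close>, because
  \<open>E \<parallel>F (z + \<mu> u)\<parallel>\<^sub>*\<^sup>2 \<le> \<parallel>E F (z + \<mu> u)\<parallel>\<^sub>*\<^sup>2 + L1\<^sup>2 \<mu>\<^sup>2 E \<parallel>u\<parallel>\<^sup>2\<close> and \<open>E \<parallel>u\<parallel>\<^sup>2 \<le> d\<close>. The two combine to a
  bound on \<open>E |F y|\<^sup>2\<close> by the decrease of \<open>E |z - z*|\<^sup>2\<close>, and this telescopes.\<close>

section \<open>Self-adjoint operators and their extreme eigenvalues\<close>

text \<open>The Bochner integral of a non-integrable function is 0, so a bound on an expectation,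
  the variance hypothesis included, carries information only once integrability is known. The
  Lipschitz gradient gives \<open>f\<close> at most quadratic growth; with exponential moments of
  the Gaussian this makes the functions of one sample that occur integrable, and an induction over
  the iterations keeps the iterates square integrable. Fubini takes the place of conditional
  expectation: a measurable function of earlier samples and a fresh sample are jointly distributed
  by a product measure. The oracle is unbiased by Gaussian integration by parts. The Gaussian is a
  probability measure because it is the law of a sample, so its normalising constant is never
  evaluated. The step sizes enter at the end: \<open>h2 \<le> h1 / 2\<close> leaves at least
  \<open>h2\<^sup>2\<close> of the decrease \<open>h1 * h2 - h2\<^sup>2\<close>, and the lower bound
  on \<open>h2\<close> makes this outweigh the loss caused by \<open>\<rho>\<close>.\<close>

lemma psd_null_vector:
  fixes P :: "'a::real_inner \<Rightarrow> 'a"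
  assumes "linear P" and sym: "\<And>x y. x \<bullet> P y = P x \<bullet> y"
    and psd: "\<And>x. 0 \<le> x \<bullet> P x" and v: "v \<bullet> P v = 0"
  shows "P v = 0"
proof -
  interpret linear P by fact
  \<comment> \<open>Along the line through \<open>v\<close> in direction \<open>P v\<close> the form
    is a quadratic in \<open>s\<close> without constant term. Being nonnegative for all
    \<open>s\<close>, it cannot have the linear term \<open>2 * s * (P v \<bullet> P v)\<close>
    unless \<open>P v = 0\<close>.\<close>
  have ineq: "0 \<le> 2 * s * (P v \<bullet> P v) + s\<^sup>2 * (P v \<bullet> P (P v))" for s
  proof -
    have "0 \<le> (v + s *\<^sub>R P v) \<bullet> P (v + s *\<^sub>R P v)"
      by (rule psd)
    also have "\<dots> = v \<bullet> P v + s * (v \<bullet> P (P v)) + s * (P v \<bullet> P v) + s\<^sup>2 * (P v \<bullet> P (P v))"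
      by (simp add: add scale inner_add_left inner_add_right algebra_simps power2_eq_square)
    also have "v \<bullet> P (P v) = P v \<bullet> P v"
      by (rule sym)
    finally show ?thesis
      by (simp add: v algebra_simps)
  qed
  define a where "a = P v \<bullet> P v"
  define b where "b = P v \<bullet> P (P v)"
  have "0 \<le> a" "0 \<le> b"
    by (simp_all add: a_def b_def psd)
  have "a = 0"
  proof (rule ccontr)
    assume "a \<noteq> 0"
    with \<open>0 \<le> a\<close> have "a > 0" by simp
    \<comment> \<open>The minimiser is \<open>- a / b\<close>; adding 1 keeps the denominator
      nonzero when \<open>b = 0\<close> and still makes the value negative.\<close>
    define s where "s = - a / (b + 1)"
    have "0 \<le> 2 * s * a + s\<^sup>2 * b"
      using ineq[of s] by (simp add: a_def b_def)
    also have "\<dots> = - (a\<^sup>2 / (b + 1)) * (2 - b / (b + 1))"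
    proof -
      have "b + 1 \<noteq> 0"
        using \<open>0 \<le> b\<close> by simp
      then show ?thesis
        unfolding s_def power2_eq_square by (simp add: divide_simps) algebra
    qed
    also have "\<dots> < 0"
      using \<open>0 \<le> b\<close> \<open>a > 0\<close> by (intro mult_neg_pos) (auto simp: field_simps)
    finally show False by simp
  qed
  then show ?thesis by (simp add: a_def)
qed

text \<open>By compactness the form has a maximiser \<open>v\<close> on the unit sphere. The
  operator \<open>l *\<^sub>R x - P x\<close> is then positive semidefinite and its form vanishes at
  \<open>v\<close>, so \<open>psd_null_vector\<close> yields the eigenvector equation without any
  differentiation.\<close>

lemma rayleigh_max:
  fixes P :: "'a::euclidean_space \<Rightarrow> 'a"
  assumes "linear P" and sym: "\<And>x y. x \<bullet> P y = P x \<bullet> y"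
  obtains l v where "v \<noteq> 0" "P v = l *\<^sub>R v" "\<And>x. x \<bullet> P x \<le> l * (x \<bullet> x)"
proof -
  interpret linear P by fact
  have "continuous_on (sphere 0 1) (\<lambda>x. x \<bullet> P x)"
    by (intro continuous_intros linear_continuous_on linear_conv_bounded_linear[THEN iffD1] assms)
  then obtain v where v: "v \<in> sphere 0 1" and max: "\<And>x. x \<in> sphere 0 1 \<Longrightarrow> x \<bullet> P x \<le> v \<bullet> P v"
    using continuous_attains_sup[of "sphere 0 1" "\<lambda>x. x \<bullet> P x"] by auto
  define l where "l = v \<bullet> P v"
  have bound: "x \<bullet> P x \<le> l * (x \<bullet> x)" for x
  proof (cases "x = 0")
    case False
    then have "(x /\<^sub>R norm x) \<bullet> P (x /\<^sub>R norm x) \<le> l"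
      unfolding l_def by (intro max) simp
    then have "(x \<bullet> P x) / (norm x)\<^sup>2 \<le> l"
      by (simp add: scale power2_eq_square field_simps)
    then show ?thesis
      using False by (simp add: field_simps power2_norm_eq_inner)
  qed (simp add: zero)
  have "l *\<^sub>R v - P v = 0"
  proof (rule psd_null_vector[where P = "\<lambda>x. l *\<^sub>R x - P x"])
    show "linear (\<lambda>x. l *\<^sub>R x - P x)"
      by (intro linearI) (simp_all add: add scale algebra_simps)
    show "v \<bullet> (l *\<^sub>R v - P v) = 0"
      using v by (simp add: inner_diff_right l_def dot_square_norm)
  qed (simp_all add: inner_diff_right inner_diff_left sym bound[unfolded sym])
  with v bound show ?thesis
    by (intro that[of v l]) auto
qed

text \<open>\<open>Min\<close> and \<open>Max\<close> of the spectrum have their meaning only on a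
  finite set. Eigenvectors for distinct eigenvalues are orthogonal, so choosing one per eigenvalue
  gives an independent set, which is finite in finite dimension.\<close>

lemma finite_eigenvalues:
  fixes P :: "'a::euclidean_space \<Rightarrow> 'a"
  assumes sym: "\<And>x y. x \<bullet> P y = P x \<bullet> y"
  shows "finite {l. \<exists>v. v \<noteq> 0 \<and> P v = l *\<^sub>R v}" (is "finite ?E")
proof -
  define w where "w l = (SOME v. v \<noteq> 0 \<and> P v = l *\<^sub>R v)" for l
  have w: "w l \<noteq> 0" "P (w l) = l *\<^sub>R w l" if "l \<in> ?E" for l
    using that someI_ex[of "\<lambda>v. v \<noteq> 0 \<and> P v = l *\<^sub>R v"] by (auto simp: w_def)
  have orth: "w l \<bullet> w l' = 0" if "l \<in> ?E" "l' \<in> ?E" "l \<noteq> l'" for l l'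
    using sym[of "w l" "w l'"] w[OF that(1)] w[OF that(2)] that(3) by simp
  have "inj_on w ?E"
  proof (rule inj_onI, rule ccontr)
    fix l l' assume "l \<in> ?E" "l' \<in> ?E" "w l = w l'" "l \<noteq> l'"
    with orth[of l l'] w(1)[of l] show False
      by simp
  qed
  moreover have "finite (w ` ?E)"
  proof (rule independent_imp_finite, rule pairwise_orthogonal_independent)
    show "pairwise orthogonal (w ` ?E)"
      using orth unfolding pairwise_image pairwise_def orthogonal_def by blast
    show "0 \<notin> w ` ?E"
      using w(1) by force
  qed
  ultimately show ?thesis
    using finite_imageD by blast
qed

lemma eigenvalue_extremes:
  fixes P :: "'a::euclidean_space \<Rightarrow> 'a"
  assumes "linear P" and sym: "\<And>x y. x \<bullet> P y = P x \<bullet> y"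
  defines "E \<equiv> {l. \<exists>v. v \<noteq> 0 \<and> P v = l *\<^sub>R v}"
  shows "Min E \<in> E" "Max E \<in> E"
    and "Min E * (x \<bullet> x) \<le> x \<bullet> P x" "x \<bullet> P x \<le> Max E * (x \<bullet> x)"
proof -
  obtain l v where l: "v \<noteq> 0" "P v = l *\<^sub>R v" "\<And>x. x \<bullet> P x \<le> l * (x \<bullet> x)"
    using rayleigh_max[OF assms(1,2)] by blast
  \<comment> \<open>The lower Rayleigh bound is the upper one for the negated operator.\<close>
  have "linear (\<lambda>x. - P x)"
    using linear_compose_neg[OF assms(1)] .
  then obtain l' v' where l': "v' \<noteq> 0" "- P v' = l' *\<^sub>R v'" "\<And>x. x \<bullet> (- P x) \<le> l' * (x \<bullet> x)"
    by (rule rayleigh_max) (auto simp: sym)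
  have eig': "P v' = (- l') *\<^sub>R v'"
    using l'(2) by (simp flip: l'(2))
  have low: "- l' * (x \<bullet> x) \<le> x \<bullet> P x" for x
    using l'(3)[of x] by simp
  have fin: "finite E"
    unfolding E_def by (rule finite_eigenvalues) (rule sym)
  have mem: "l \<in> E" "- l' \<in> E"
    unfolding E_def using l(1,2) l'(1) eig' by blast+
  with fin show "Min E \<in> E" "Max E \<in> E"
    by (auto intro!: Min_in Max_in)
  have "Min E \<le> - l'" "l \<le> Max E"
    using fin mem by auto
  then show "Min E * (x \<bullet> x) \<le> x \<bullet> P x" "x \<bullet> P x \<le> Max E * (x \<bullet> x)"
    by (meson l(3) low inner_ge_zero mult_right_mono order_trans)+
qed

lemma form_cauchy_schwarz:
  fixes P :: "'a::real_inner \<Rightarrow> 'a"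
  assumes "linear P" and sym: "\<And>x y. x \<bullet> P y = P x \<bullet> y" and psd: "\<And>x. 0 \<le> x \<bullet> P x"
  shows "(x \<bullet> P y)\<^sup>2 \<le> (x \<bullet> P x) * (y \<bullet> P y)"
proof -
  interpret linear P by fact
  have ineq: "0 \<le> a\<^sup>2 * (x \<bullet> P x) - 2 * a * b * (x \<bullet> P y) + b\<^sup>2 * (y \<bullet> P y)" for a b
  proof -
    have "0 \<le> (a *\<^sub>R x - b *\<^sub>R y) \<bullet> P (a *\<^sub>R x - b *\<^sub>R y)"
      by (rule psd)
    also have "\<dots> = a\<^sup>2 * (x \<bullet> P x) - a * b * (x \<bullet> P y) - a * b * (y \<bullet> P x) + b\<^sup>2 * (y \<bullet> P y)"
      by (simp add: diff scale inner_diff_left inner_diff_right algebra_simps power2_eq_square)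
    also have "y \<bullet> P x = x \<bullet> P y"
      by (metis sym inner_commute)
    finally show ?thesis by (simp add: algebra_simps)
  qed
  show ?thesis
  proof (cases "y \<bullet> P y = 0")
    case True
    then have "P y = 0"
      by (rule psd_null_vector[OF assms])
    then show ?thesis by simp
  next
    case False
    then have "y \<bullet> P y > 0"
      using psd[of y] by simp
    \<comment> \<open>The weights \<open>a = y \<bullet> P y\<close> and
      \<open>b = x \<bullet> P y\<close> are the optimal ones up to scaling; with them a factor
      \<open>y \<bullet> P y\<close> splits off.\<close>
    moreover have "0 \<le> (y \<bullet> P y) * ((x \<bullet> P x) * (y \<bullet> P y) - (x \<bullet> P y)\<^sup>2)"
      using ineq[of "y \<bullet> P y" "x \<bullet> P y"] by (simp add: algebra_simps power2_eq_square)
    ultimately show ?thesis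
      by (simp add: zero_le_mult_iff)
  qed
qed

section \<open>Gaussian measures with a positive definite form\<close>

lemma lborel_integrable_affine:
  fixes g :: "'a::euclidean_space \<Rightarrow> 'b::{banach, second_countable_topology}"
  assumes "r \<noteq> 0" and g: "integrable lborel g"
  shows "integrable lborel (\<lambda>x. g (b + r *\<^sub>R x))"
proof -
  have [measurable]: "g \<in> borel_measurable borel"
    using borel_measurable_integrable[OF g] by simp
  have "integrable (density (distr lborel borel (\<lambda>x. b + r *\<^sub>R x)) (\<lambda>_. ennreal (\<bar>r\<bar> ^ DIM('a)))) g"
    using g lborel_affine[OF assms(1), of b] by (simp add: ennreal_power)
  then have "integrable lborel (\<lambda>x. \<bar>r\<bar> ^ DIM('a) *\<^sub>R g (b + r *\<^sub>R x))"
    by (simp add: integrable_density integrable_distr_eq)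
  then have "integrable lborel (\<lambda>x. inverse (\<bar>r\<bar> ^ DIM('a)) *\<^sub>R \<bar>r\<bar> ^ DIM('a) *\<^sub>R g (b + r *\<^sub>R x))"
    by (rule integrable_scaleR_right)
  then show ?thesis
    using assms(1) by simp
qed

lemma lborel_integral_affine:
  fixes g :: "'a::euclidean_space \<Rightarrow> 'b::{banach, second_countable_topology}"
  assumes "r \<noteq> 0" and [measurable]: "g \<in> borel_measurable borel"
  shows "(\<integral>x. g x \<partial>lborel) = \<bar>r\<bar> ^ DIM('a) *\<^sub>R (\<integral>x. g (b + r *\<^sub>R x) \<partial>lborel)"
proof -
  have "(\<integral>x. g x \<partial>lborel) =
      (\<integral>x. g x \<partial>density (distr lborel borel (\<lambda>x. b + r *\<^sub>R x)) (\<lambda>_. ennreal (\<bar>r\<bar> ^ DIM('a))))"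
    using lborel_affine[OF assms(1), of b] by (simp add: ennreal_power)
  then show ?thesis
    by (simp add: integral_density integral_distr)
qed

text \<open>An explicit quadratic remainder allows an exponential to be expanded under an integral
  without a limit theorem.\<close>

lemma abs_exp_taylor2_le:
  fixes x :: real
  shows "\<bar>exp x - 1 - x\<bar> \<le> x\<^sup>2 * exp \<bar>x\<bar>"
proof -
  obtain t where t: "\<bar>t\<bar> \<le> \<bar>x\<bar>" "exp x = (\<Sum>m<2. x ^ m / fact m) + exp t / fact 2 * x ^ 2"
    using Maclaurin_exp_le[of x 2] by blast
  then have "exp x - 1 - x = exp t / 2 * x\<^sup>2"
    by (simp add: numeral_2_eq_2)
  then have "\<bar>exp x - 1 - x\<bar> = \<bar>exp t / 2 * x\<^sup>2\<bar>"
    by presburger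
  also have "\<dots> = exp t / 2 * x\<^sup>2"
    by simp
  also have "exp t / 2 \<le> exp \<bar>x\<bar>"
  proof -
    have "exp t \<le> exp \<bar>x\<bar>"
      using t(1) by simp
    then show ?thesis
      using exp_gt_zero[of "\<bar>x\<bar>"] by linarith
  qed
  then have "exp t / 2 * x\<^sup>2 \<le> exp \<bar>x\<bar> * x\<^sup>2"
    by (rule mult_right_mono) simp
  finally show ?thesis by (simp add: mult.commute)
qed

text \<open>\<open>A\<close> is the inverse of \<open>B\<close>. The factor \<open>Z\<close> stays
  abstract: its only known property is that the total mass is 1, and moments are derived from this
  by substitution in the Lebesgue integral.\<close>

locale gaussian_form =
  fixes B A :: "'a::euclidean_space \<Rightarrow> 'a" and lo hi Z :: real and \<gamma> :: "'a measure"
  assumes linear_B: "linear B" and linear_A: "linear A"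
    and sym: "\<And>x y. x \<bullet> B y = B x \<bullet> y"
    and A_B [simp]: "\<And>x. A (B x) = x" and B_A [simp]: "\<And>x. B (A x) = x"
    and lo_pos: "0 < lo"
    and lo_le: "\<And>x. lo * (x \<bullet> x) \<le> x \<bullet> B x" and le_hi: "\<And>x. x \<bullet> B x \<le> hi * (x \<bullet> x)"
    and gauss_eq: "\<gamma> = density lborel (\<lambda>u. ennreal (Z * exp (- (u \<bullet> B u) / 2)))"
    and prob: "prob_space \<gamma>"
begin

sublocale gauss: prob_space \<gamma>
  by (rule prob)

lemma sets_gauss [measurable_cong, simp]: "sets \<gamma> = sets borel"
  by (simp add: gauss_eq)

lemma space_gauss [simp]: "space \<gamma> = UNIV"
  by (simp add: gauss_eq)

lemma bounded_linear_B: "bounded_linear B"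
  using linear_B by (simp add: linear_conv_bounded_linear)

lemma bounded_linear_A: "bounded_linear A"
  using linear_A by (simp add: linear_conv_bounded_linear)

lemma continuous_B [continuous_intros]: "continuous_on X f \<Longrightarrow> continuous_on X (\<lambda>x. B (f x))"
  by (rule bounded_linear.continuous_on[OF bounded_linear_B])

lemma measurable_B [measurable]: "B \<in> borel_measurable borel"
  by (intro borel_measurable_continuous_onI continuous_intros)

lemma measurable_A [measurable]: "A \<in> borel_measurable borel"
  by (intro borel_measurable_continuous_onI bounded_linear.continuous_on[OF bounded_linear_A]
      continuous_intros)

lemma B_nonneg: "0 \<le> x \<bullet> B x"
  by (rule order_trans[OF _ lo_le]) (simp add: lo_pos less_imp_le)

lemma sym_A: "x \<bullet> A y = A x \<bullet> y"
  by (metis B_A sym)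

lemma A_nonneg: "0 \<le> x \<bullet> A x"
  by (metis B_A B_nonneg inner_commute)

lemma hi_pos: "0 < hi"
proof -
  obtain b :: 'a where "b \<in> Basis"
    using nonempty_Basis by blast
  then show ?thesis
    using lo_le[of b] le_hi[of b] lo_pos by simp
qed

text \<open>Cauchy-Schwarz for the form of \<open>B\<close> at the points \<open>A x\<close> and
  \<open>y\<close>: because \<open>B (A x) = x\<close>, the form at \<open>A x\<close> is the dual
  form at \<open>x\<close>.\<close>

lemma dual_pairing: "x \<bullet> y \<le> sqrt (x \<bullet> A x) * sqrt (y \<bullet> B y)"
proof -
  have "(x \<bullet> y)\<^sup>2 \<le> (x \<bullet> A x) * (y \<bullet> B y)"
    using form_cauchy_schwarz[OF linear_B sym B_nonneg, of "A x" y]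
    by (simp add: sym[of "A x"] inner_commute[of "A x" x])
  then have "\<bar>x \<bullet> y\<bar> \<le> sqrt ((x \<bullet> A x) * (y \<bullet> B y))"
    by (metis real_sqrt_abs real_sqrt_le_iff)
  then show ?thesis
    by (simp add: real_sqrt_mult)
qed

lemma norm_le_dual: "x \<bullet> x \<le> hi * (x \<bullet> A x)"
proof -
  have "(x \<bullet> x)\<^sup>2 \<le> (x \<bullet> A x) * (x \<bullet> B x)"
    using form_cauchy_schwarz[OF linear_B sym B_nonneg, of "A x" x]
    by (simp add: sym[of "A x" x] inner_commute[of "A x" x])
  also have "\<dots> \<le> (x \<bullet> A x) * (hi * (x \<bullet> x))"
    by (intro mult_left_mono le_hi A_nonneg)
  finally have "(x \<bullet> x) * (x \<bullet> x) \<le> (x \<bullet> x) * (hi * (x \<bullet> A x))"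
    by (simp add: power2_eq_square mult_ac)
  then show ?thesis
    by (cases "x = 0") (auto simp: linear_0[OF linear_A] mult_le_cancel_left_pos)
qed

lemma dual_le_norm: "lo * (x \<bullet> A x) \<le> x \<bullet> x"
proof -
  have "0 \<le> (x - lo *\<^sub>R A x) \<bullet> (x - lo *\<^sub>R A x)"
    by simp
  also have "\<dots> = x \<bullet> x - 2 * lo * (x \<bullet> A x) + lo * (lo * (A x \<bullet> A x))"
    by (simp add: inner_diff_left inner_diff_right algebra_simps inner_commute[of "A x" x])
  also have "lo * (A x \<bullet> A x) \<le> x \<bullet> A x"
    using lo_le[of "A x"] by (simp add: inner_commute[of "A x" x])
  finally show ?thesis
    using lo_pos by (simp add: mult_left_mono algebra_simps)
qed

text \<open>\<open>ennreal\<close> truncates negative reals to 0, so \<open>Z \<le> 0\<close> would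
  produce the zero measure, which is not a probability measure.\<close>

lemma Z_pos: "0 < Z"
proof (rule ccontr)
  assume "\<not> 0 < Z"
  then have "Z * exp (- (u \<bullet> B u) / 2) \<le> 0" for u
    by (simp add: mult_nonpos_nonneg)
  then have "\<gamma> = density lborel (\<lambda>_. 0)"
    by (simp add: gauss_eq ennreal_neg)
  then have "emeasure \<gamma> (space \<gamma>) = 0"
    by (simp add: emeasure_density)
  then show False
    using gauss.emeasure_space_1 by simp
qed

section \<open>Moments of the Gaussian measure\<close>

lemma integrable_gauss_iff:
  fixes h :: "'a \<Rightarrow> 'b::{banach, second_countable_topology}"
  assumes [measurable]: "h \<in> borel_measurable borel"
  shows "integrable \<gamma> h \<longleftrightarrow> integrable lborel (\<lambda>u. (Z * exp (- (u \<bullet> B u) / 2)) *\<^sub>R h u)"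
  unfolding gauss_eq using Z_pos by (intro integrable_density) auto

lemma integral_gauss:
  fixes h :: "'a \<Rightarrow> 'b::{banach, second_countable_topology}"
  assumes [measurable]: "h \<in> borel_measurable borel"
  shows "(\<integral>u. h u \<partial>\<gamma>) = (\<integral>u. (Z * exp (- (u \<bullet> B u) / 2)) *\<^sub>R h u \<partial>lborel)"
  unfolding gauss_eq using Z_pos by (intro integral_density) auto

lemma density_integrable: "integrable lborel (\<lambda>u. Z * exp (- (u \<bullet> B u) / 2))"
  using integrable_gauss_iff[of "\<lambda>_. 1 :: real"] by simp

lemma B_scaleR: "B (r *\<^sub>R x) = r *\<^sub>R B x"
  by (rule linear_scale[OF linear_B])

text \<open>The density with its argument shrunk by \<open>r\<close> is still Lebesgue integrable,
  and up to the factor \<open>exp (a\<^sup>2 / lo)\<close> it dominates the density multiplied by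
  \<open>exp (a * norm u)\<close>.\<close>

lemma integrable_exp_norm: "integrable \<gamma> (\<lambda>u. exp (a * norm u))"
proof -
  \<comment> \<open>With this \<open>r\<close> the shrunk form is at most
    \<open>lo * (norm u)\<^sup>2 / 2\<close>. That is half of the lower bound for
    \<open>u \<bullet> B u\<close>; the other half absorbs \<open>a * norm u\<close> by Young's
    inequality.\<close>
  define r where "r = sqrt (lo / (2 * hi))"
  have r: "r > 0" "r\<^sup>2 = lo / (2 * hi)"
    using lo_pos hi_pos by (simp_all add: r_def)
  have int: "integrable lborel (\<lambda>u. exp (a\<^sup>2 / lo) * (Z * exp (- (r\<^sup>2 * (u \<bullet> B u)) / 2)))"
    using lborel_integrable_affine[OF _ density_integrable, of r 0] r(1)
    by (simp add: B_scaleR power2_eq_square mult.assoc)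
  have bound: "exp (- (u \<bullet> B u) / 2) * exp (a * norm u) \<le>
      exp (a\<^sup>2 / lo) * exp (- (r\<^sup>2 * (u \<bullet> B u)) / 2)" for u
  proof -
    have "r\<^sup>2 * (u \<bullet> B u) \<le> r\<^sup>2 * (hi * (u \<bullet> u))"
      by (intro mult_left_mono le_hi) simp
    also have "\<dots> = lo * (u \<bullet> u) / 2"
      using hi_pos by (simp add: r(2))
    finally have 1: "r\<^sup>2 * (u \<bullet> B u) \<le> lo * (norm u)\<^sup>2 / 2"
      by (simp add: power2_norm_eq_inner)
    have "0 \<le> (a / lo - norm u / 2)\<^sup>2"
      by simp
    also have "\<dots> = (a\<^sup>2 / lo + lo * (norm u)\<^sup>2 / 4 - a * norm u) / lo"
      using lo_pos by (simp add: power2_eq_square field_simps)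
    finally have 2: "a * norm u \<le> a\<^sup>2 / lo + lo * (norm u)\<^sup>2 / 4"
      using lo_pos by (simp add: zero_le_divide_iff)
    have "- (u \<bullet> B u) / 2 + a * norm u \<le> a\<^sup>2 / lo + - (r\<^sup>2 * (u \<bullet> B u)) / 2"
      using 1 2 lo_le[of u] by (simp add: power2_norm_eq_inner)
    then show ?thesis
      by (simp flip: exp_add)
  qed
  show ?thesis
  proof (subst integrable_gauss_iff)
    show "integrable lborel (\<lambda>u. (Z * exp (- (u \<bullet> B u) / 2)) *\<^sub>R exp (a * norm u))"
      using Z_pos bound by (intro Bochner_Integration.integrable_bound[OF int]) (auto simp: mult.assoc mult.left_commute[of _ Z])
  qed simp
qed

text \<open>Integrands below are shown to grow at most exponentially and then fall under this
  criterion; the constants may depend on the base point.\<close>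

lemma integrable_exp_bound:
  fixes h :: "'a \<Rightarrow> 'b::{banach, second_countable_topology}"
  assumes "h \<in> borel_measurable borel" and "\<And>u. norm (h u) \<le> C * exp (a * norm u)"
  shows "integrable \<gamma> h"
proof (rule Bochner_Integration.integrable_bound)
  show "integrable \<gamma> (\<lambda>u. C * exp (a * norm u))"
    by (intro integrable_mult_right integrable_exp_norm)
qed (use assms(1) order_trans[OF assms(2) abs_ge_self] in auto)

lemma norm_le_exp: "norm u \<le> exp (norm u)" for u :: 'a
  using exp_ge_add_one_self[of "norm u"] by linarith

lemma integrable_id: "integrable \<gamma> (\<lambda>u. u)"
  using norm_le_exp by (intro integrable_exp_bound[where C = 1 and a = 1]) auto

lemma integral_id: "(\<integral>u. u \<partial>\<gamma>) = 0"
proof -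
  have "(\<integral>u. u \<partial>\<gamma>) = (\<integral>u. (Z * exp (- (u \<bullet> B u) / 2)) *\<^sub>R u \<partial>lborel)"
    by (rule integral_gauss) simp
  \<comment> \<open>The density is even, so reflecting \<open>u\<close> turns the mean into its own
    negative.\<close>
  also have "\<dots> = (\<integral>u. - ((Z * exp (- (u \<bullet> B u) / 2)) *\<^sub>R u) \<partial>lborel)"
    by (subst lborel_integral_affine[where r = "-1" and b = 0]) (auto simp: linear_neg[OF linear_B])
  also have "\<dots> = - (\<integral>u. u \<partial>\<gamma>)"
    by (simp add: integral_gauss)
  finally have "2 *\<^sub>R (\<integral>u. u \<partial>\<gamma>) = 0"
    by (simp add: scaleR_2 eq_neg_iff_add_eq_0)
  then show ?thesis by simp
qed

lemma form_le_exp: "u \<bullet> B u \<le> hi * exp (2 * norm u)"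
proof -
  have "u \<bullet> B u \<le> hi * (norm u * norm u)"
    using le_hi by (simp add: dot_square_norm power2_eq_square)
  also have "\<dots> \<le> hi * (exp (norm u) * exp (norm u))"
    using hi_pos norm_le_exp by (intro mult_left_mono mult_mono) auto
  finally show ?thesis by (simp flip: exp_add)
qed

lemma integrable_form: "integrable \<gamma> (\<lambda>u. u \<bullet> B u)"
  using form_le_exp B_nonneg by (intro integrable_exp_bound[where C = hi and a = 2]) auto

text \<open>Rescaling \<open>u\<close> in the normalisation integral gives
  \<open>\<integral> exp ((1 - r\<^sup>2) (u \<bullet> B u) / 2) \<partial>\<gamma> = r powr (- DIM('a))\<close>; the moment is read off at \<open>r = 1\<close>.\<close>

lemma integral_form_le: "(\<integral>u. u \<bullet> B u \<partial>\<gamma>) \<le> DIM('a)"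
proof -
  define m where "m = (\<integral>u. u \<bullet> B u \<partial>\<gamma>)"
  \<comment> \<open>\<open>1 + x \<le> exp x\<close> under the integral turns the rescaling identity
    into \<open>h r \<le> 1 = h 1\<close>. Replacing the exponential by its tangent leaves a
    polynomial in \<open>r\<close>, so nothing is differentiated under the integral.\<close>
  define h where "h r = r ^ DIM('a) * (1 + (1 - r\<^sup>2) / 2 * m)" for r :: real
  have h_le: "h r \<le> h 1" if "r > 0" for r
  proof -
    define p where "p u = exp ((1 - r\<^sup>2) / 2 * (u \<bullet> B u))" for u
    have [measurable]: "p \<in> borel_measurable borel"
      unfolding p_def[abs_def] by measurable
    have p_eq: "(Z * exp (- (u \<bullet> B u) / 2)) *\<^sub>R p u = Z * exp (- (r *\<^sub>R u \<bullet> B (r *\<^sub>R u)) / 2)" for u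
      by (simp add: p_def mult.assoc B_scaleR flip: exp_add) (simp add: field_simps power2_eq_square)
    have "integrable lborel (\<lambda>u. Z * exp (- (r *\<^sub>R u \<bullet> B (r *\<^sub>R u)) / 2))"
      using lborel_integrable_affine[OF _ density_integrable, of r 0] that by simp
    then have int: "integrable \<gamma> p"
      by (subst integrable_gauss_iff) (auto simp only: p_eq, measurable)
    have "(\<integral>u. 1 \<partial>\<gamma>) = (\<integral>u. Z * exp (- (u \<bullet> B u) / 2) \<partial>lborel)"
      by (subst integral_gauss) simp_all
    also have "\<dots> = r ^ DIM('a) * (\<integral>u. Z * exp (- (r *\<^sub>R u \<bullet> B (r *\<^sub>R u)) / 2) \<partial>lborel)"
      using that by (subst lborel_integral_affine[where r = r and b = 0]) auto
    also have "\<dots> = r ^ DIM('a) * (\<integral>u. p u \<partial>\<gamma>)"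
      by (subst integral_gauss) (auto simp only: p_eq, measurable)
    finally have 1: "r ^ DIM('a) * (\<integral>u. p u \<partial>\<gamma>) = 1"
      using gauss.prob_space by simp
    have "1 + (1 - r\<^sup>2) / 2 * m = (\<integral>u. 1 + (1 - r\<^sup>2) / 2 * (u \<bullet> B u) \<partial>\<gamma>)"
      using integrable_form gauss.prob_space by (simp add: m_def)
    also have "\<dots> \<le> (\<integral>u. p u \<partial>\<gamma>)"
      using integrable_form int unfolding p_def by (intro integral_mono) auto
    finally have "h r \<le> r ^ DIM('a) * (\<integral>u. p u \<partial>\<gamma>)"
      unfolding h_def using that by (intro mult_left_mono) auto
    with 1 show ?thesis
      by (simp add: h_def)
  qed
  have D: "(h has_real_derivative (DIM('a) - m)) (at 1)"
    unfolding h_def[abs_def] by (auto intro!: derivative_eq_intros)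
  show ?thesis
  proof (rule ccontr)
    assume "\<not> ?thesis"
    then have "DIM('a) - m < 0"
      by (simp add: m_def)
    \<comment> \<open>A negative derivative at 1 would lift \<open>h\<close> above
      \<open>h 1\<close> just to the left of 1.\<close>
    from DERIV_neg_dec_left[OF D this] obtain e where
      e: "e > 0" "\<And>x. 0 < x \<Longrightarrow> x < e \<Longrightarrow> h 1 < h (1 - x)"
      by blast
    define x where "x = min (e / 2) (1 / 2)"
    have "0 < x" "x < e" "1 - x > 0"
      using e(1) by (auto simp: x_def min_def)
    with e(2)[of x] h_le[of "1 - x"] show False
      by simp
  qed
qed

end

section \<open>Gaussian smoothing\<close>

text \<open>\<open>S\<close> stands for the sign change of the second block, which turns the
  gradient into the saddle operator. Only its being an isometric involution that commutes with
  \<open>B\<close> is used here, so the product structure of the space stays out of sight.\<close>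

locale smooth_saddle = gaussian_form B A lo hi Z \<gamma>
  for B A :: "'a::euclidean_space \<Rightarrow> 'a" and lo hi Z :: real and \<gamma> :: "'a measure" +
  fixes f :: "'a \<Rightarrow> real" and g S :: "'a \<Rightarrow> 'a" and L1 \<mu> :: real
  assumes gderiv: "\<And>w. GDERIV f w :> g w"
    and dual_lipschitz: "\<And>w w'. sqrt ((g w - g w') \<bullet> A (g w - g w')) \<le> L1 * sqrt ((w - w') \<bullet> B (w - w'))"
    and L1_pos: "0 < L1" and mu_pos: "0 < \<mu>"
    and linear_S: "linear S" and S_inner [simp]: "\<And>x y. S x \<bullet> S y = x \<bullet> y"
    and S_S [simp]: "\<And>x. S (S x) = x"
    and B_S: "\<And>x. B (S x) = S (B x)"
begin

definition F where "F w = S (g w)"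
definition smoothed where "smoothed w = (\<integral>u. f (w + \<mu> *\<^sub>R u) \<partial>\<gamma>)"
definition smoothed_grad where "smoothed_grad w = (\<integral>u. g (w + \<mu> *\<^sub>R u) \<partial>\<gamma>)"
definition F\<mu> where "F\<mu> w = S (smoothed_grad w)"
definition estimator where "estimator w u = ((f (w + \<mu> *\<^sub>R u) - f w) / \<mu>) *\<^sub>R S (B u)"

lemma bounded_linear_S: "bounded_linear S"
  using linear_S by (simp add: linear_conv_bounded_linear)

lemma measurable_S [measurable]: "S \<in> borel_measurable borel"
  by (intro borel_measurable_continuous_onI bounded_linear.continuous_on[OF bounded_linear_S]
      continuous_intros)

lemma norm_S [simp]: "norm (S x) = norm x"
  by (simp add: norm_eq_sqrt_inner)

lemma A_S: "A (S x) = S (A x)"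
  by (metis A_B B_A B_S)

lemma S_diff: "S (x - y) = S x - S y"
  by (rule linear_diff[OF linear_S])

lemma dual_lipschitz_sq: "(g w - g w') \<bullet> A (g w - g w') \<le> L1\<^sup>2 * ((w - w') \<bullet> B (w - w'))"
proof -
  have "(sqrt ((g w - g w') \<bullet> A (g w - g w')))\<^sup>2 \<le> (L1 * sqrt ((w - w') \<bullet> B (w - w')))\<^sup>2"
    by (intro power_mono dual_lipschitz) (simp add: A_nonneg)
  then show ?thesis
    by (simp add: A_nonneg B_nonneg power_mult_distrib)
qed

text \<open>Passing from the dual norm to the Euclidean one costs \<open>sqrt hi\<close>, and
  passing from the norm of \<open>B\<close> to the Euclidean one costs it again; hence the factor
  \<open>hi\<close>.\<close>

lemma lipschitz: "norm (g w - g w') \<le> L1 * hi * norm (w - w')"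
proof -
  have "(norm (g w - g w'))\<^sup>2 \<le> hi * ((g w - g w') \<bullet> A (g w - g w'))"
    using norm_le_dual by (simp add: power2_norm_eq_inner)
  also have "\<dots> \<le> hi * (L1\<^sup>2 * ((w - w') \<bullet> B (w - w')))"
    using hi_pos by (intro mult_left_mono dual_lipschitz_sq) simp
  also have "\<dots> \<le> hi * (L1\<^sup>2 * (hi * ((w - w') \<bullet> (w - w'))))"
    using hi_pos by (intro mult_left_mono le_hi) auto
  also have "\<dots> = (L1 * hi * norm (w - w'))\<^sup>2"
    by (simp add: power_mult_distrib power2_norm_eq_inner) (simp add: power2_eq_square)
  finally show ?thesis
    using L1_pos hi_pos by (rule_tac power2_le_imp_le) simp_all
qed

lemma continuous_g: "continuous_on UNIV g"
proof (rule lipschitz_on_continuous_on)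
  show "(L1 * hi)-lipschitz_on UNIV g"
    using L1_pos hi_pos lipschitz by (intro lipschitz_onI) (auto simp: dist_norm)
qed

lemma continuous_f: "continuous_on UNIV f"
  using gderiv has_derivative_continuous unfolding gderiv_def
  by (blast intro: continuous_at_imp_continuous_on)

lemma measurable_g [measurable]: "g \<in> borel_measurable borel"
  and measurable_f [measurable]: "f \<in> borel_measurable borel"
  using continuous_g continuous_f by (auto intro: borel_measurable_continuous_onI)

text \<open>The mean value theorem gives this without the factor 1/2 of the integral form. The
  constant serves only integrability and differentiation, where its size is irrelevant.\<close>

lemma taylor: "\<bar>f (w + h) - f w - h \<bullet> g w\<bar> \<le> L1 * hi * (norm h)\<^sup>2"
proof -
  have der: "((\<lambda>t. f (w + t *\<^sub>R h)) has_real_derivative (h \<bullet> g (w + t *\<^sub>R h))) (at t)" for t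
  proof -
    have "((\<lambda>t. w + t *\<^sub>R h) has_derivative (\<lambda>s. s *\<^sub>R h)) (at t)"
      by (auto intro!: derivative_eq_intros)
    then have "((\<lambda>t. f (w + t *\<^sub>R h)) has_derivative (\<lambda>s. (s *\<^sub>R h) \<bullet> g (w + t *\<^sub>R h))) (at t)"
      using gderiv[of "w + t *\<^sub>R h"] unfolding gderiv_def by (rule has_derivative_compose)
    then show ?thesis
      by (simp add: has_field_derivative_def mult_commute_abs)
  qed
  obtain t where t: "0 < t" "t < 1" "f (w + 1 *\<^sub>R h) - f (w + 0 *\<^sub>R h) = (1 - 0) * (h \<bullet> g (w + t *\<^sub>R h))"
    using MVT2[OF zero_less_one der] by blast
  then have "f (w + h) - f w - h \<bullet> g w = h \<bullet> (g (w + t *\<^sub>R h) - g w)"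
    by (simp add: inner_diff_right)
  then have 1: "\<bar>f (w + h) - f w - h \<bullet> g w\<bar> \<le> norm h * norm (g (w + t *\<^sub>R h) - g w)"
    by (simp only: Cauchy_Schwarz_ineq2)
  have "norm (g (w + t *\<^sub>R h) - g w) \<le> L1 * hi * (t * norm h)"
    using lipschitz[of "w + t *\<^sub>R h" w] t by simp
  also have "\<dots> \<le> L1 * hi * norm h"
    using t L1_pos hi_pos by (intro mult_left_mono mult_left_le_one_le) simp_all
  finally have "norm h * norm (g (w + t *\<^sub>R h) - g w) \<le> norm h * (L1 * hi * norm h)"
    by (rule mult_left_mono) simp
  with 1 show ?thesis
    by (simp add: power2_eq_square mult_ac)
qed

section \<open>Growth bounds and the gradient of the smoothed function\<close>

lemma g_le_exp: "norm (g (w + \<mu> *\<^sub>R u)) \<le> (norm (g w) + L1 * hi) * exp (\<mu> * norm u)"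
proof -
  have "norm (g (w + \<mu> *\<^sub>R u)) \<le> norm (g w) + norm (g (w + \<mu> *\<^sub>R u) - g w)"
    by (rule norm_triangle_sub)
  also have "\<dots> \<le> norm (g w) * 1 + L1 * hi * norm (\<mu> *\<^sub>R u)"
    using lipschitz[of "w + \<mu> *\<^sub>R u" w] by simp
  also have "norm (g w) * 1 \<le> norm (g w) * exp (\<mu> * norm u)"
    using mu_pos by (intro mult_left_mono) simp_all
  also have "L1 * hi * norm (\<mu> *\<^sub>R u) \<le> L1 * hi * exp (norm (\<mu> *\<^sub>R u))"
    using L1_pos hi_pos by (intro mult_left_mono norm_le_exp) simp
  finally show ?thesis
    using mu_pos by (simp add: algebra_simps)
qed

lemma f_le_exp:
  "\<bar>f (w + \<mu> *\<^sub>R u)\<bar> \<le> (\<bar>f w\<bar> + norm (g w) + L1 * hi) * exp (2 * \<mu> * norm u)"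
proof -
  define y where "y = norm (\<mu> *\<^sub>R u)"
  have y: "0 \<le> y" "y \<le> exp y" "1 \<le> exp y"
    unfolding y_def using norm_le_exp[of "\<mu> *\<^sub>R u"] by simp_all
  have y2: "y\<^sup>2 \<le> exp (2 * y)"
    using power_mono[OF y(2,1), of 2] by (simp flip: exp_of_nat_mult)
  have "\<bar>f (w + \<mu> *\<^sub>R u)\<bar> \<le> \<bar>f w\<bar> + \<bar>(\<mu> *\<^sub>R u) \<bullet> g w\<bar> + L1 * hi * y\<^sup>2"
    using taylor[of w "\<mu> *\<^sub>R u"] unfolding y_def by linarith
  also have "\<bar>(\<mu> *\<^sub>R u) \<bullet> g w\<bar> \<le> norm (g w) * y"
    using Cauchy_Schwarz_ineq2[of "\<mu> *\<^sub>R u" "g w"] by (simp add: y_def mult.commute)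
  also have "\<bar>f w\<bar> + norm (g w) * y + L1 * hi * y\<^sup>2 \<le>
      \<bar>f w\<bar> * exp (2 * y) + norm (g w) * exp (2 * y) + L1 * hi * exp (2 * y)"
  proof (intro add_mono mult_left_mono y2)
    show "\<bar>f w\<bar> \<le> \<bar>f w\<bar> * exp (2 * y)"
      using y(1) by (simp add: mult_le_cancel_left1)
    show "y \<le> exp (2 * y)"
      using y by (rule_tac order_trans[OF y(2)]) simp
  qed (use L1_pos hi_pos in auto)
  finally show ?thesis
    using mu_pos by (simp add: y_def algebra_simps)
qed

lemma integrable_g: "integrable \<gamma> (\<lambda>u. g (w + \<mu> *\<^sub>R u))"
  using g_le_exp by (intro integrable_exp_bound) auto

lemma integrable_f: "integrable \<gamma> (\<lambda>u. f (w + \<mu> *\<^sub>R u))"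
  using f_le_exp by (intro integrable_exp_bound[where a = "2 * \<mu>"]) auto

text \<open>The Taylor remainder of \<open>f\<close> is quadratic uniformly in the base point, so
  averaging over base points preserves it and the average of the gradients is the gradient.\<close>

lemma smoothed_gderiv: "GDERIV smoothed w :> smoothed_grad w"
proof -
  have bound: "\<bar>smoothed (w + h) - smoothed w - h \<bullet> smoothed_grad w\<bar> \<le> L1 * hi * (norm h)\<^sup>2" for h
  proof -
    have "smoothed (w + h) - smoothed w - h \<bullet> smoothed_grad w =
        (\<integral>u. f ((w + \<mu> *\<^sub>R u) + h) - f (w + \<mu> *\<^sub>R u) - h \<bullet> g (w + \<mu> *\<^sub>R u) \<partial>\<gamma>)"
      using integrable_f[of w] integrable_f[of "w + h"] integrable_g[of w]
      by (simp add: smoothed_def smoothed_grad_def add_ac)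
    also have "\<bar>\<dots>\<bar> \<le> (\<integral>u. L1 * hi * (norm h)\<^sup>2 \<partial>\<gamma>)"
    proof (rule integral_abs_bound[THEN order_trans], rule integral_mono)
      show "integrable \<gamma> (\<lambda>u. \<bar>f ((w + \<mu> *\<^sub>R u) + h) - f (w + \<mu> *\<^sub>R u) - h \<bullet> g (w + \<mu> *\<^sub>R u)\<bar>)"
        using integrable_f[of w] integrable_f[of "w + h"] integrable_g[of w]
        by (simp add: add_ac)
    qed (auto intro: taylor)
    finally show ?thesis
      using gauss.prob_space by simp
  qed
  show ?thesis
    unfolding gderiv_def
  proof (rule has_derivativeI_sandwich[where e = 1 and H = "\<lambda>y. L1 * hi * norm (y - w)"])
    show "bounded_linear (\<lambda>h. h \<bullet> smoothed_grad w)"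
      by (rule bounded_linear_inner_left)
    show "norm (smoothed y - smoothed w - (y - w) \<bullet> smoothed_grad w) / norm (y - w) \<le> L1 * hi * norm (y - w)"
      if "y \<noteq> w" for y
      using bound[of "y - w"] that by (simp add: divide_le_eq power2_eq_square mult.assoc)
    have "((\<lambda>y. L1 * hi * norm (y - w)) \<longlongrightarrow> L1 * hi * norm (w - w)) (at w)"
      by (intro tendsto_intros)
    then show "((\<lambda>y. L1 * hi * norm (y - w)) \<longlongrightarrow> 0) (at w)"
      by simp
  qed simp
qed

text \<open>The Cameron-Martin formula: translate Lebesgue measure by \<open>v\<close> and complete
  the square in the exponent.\<close>

lemma integral_shift:
  fixes p :: "'a \<Rightarrow> real"
  assumes [measurable]: "p \<in> borel_measurable borel"
  shows "(\<integral>u. p (u + v) \<partial>\<gamma>) = (\<integral>u. exp (v \<bullet> B u - v \<bullet> B v / 2) * p u \<partial>\<gamma>)"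
proof -
  have "(\<integral>u. exp (v \<bullet> B u - v \<bullet> B v / 2) * p u \<partial>\<gamma>) =
      (\<integral>u. Z * exp (- (u \<bullet> B u) / 2) * (exp (v \<bullet> B u - v \<bullet> B v / 2) * p u) \<partial>lborel)"
    by (simp add: integral_gauss)
  also have "\<dots> = (\<integral>u. Z * exp (- ((v + u) \<bullet> B (v + u)) / 2) *
      (exp (v \<bullet> B (v + u) - v \<bullet> B v / 2) * p (v + u)) \<partial>lborel)"
    by (subst lborel_integral_affine[where r = 1 and b = v]) auto
  also have "\<dots> = (\<integral>u. Z * exp (- (u \<bullet> B u) / 2) * p (u + v) \<partial>lborel)"
  proof (rule Bochner_Integration.integral_cong[OF refl])
    fix u
    have "u \<bullet> B v = v \<bullet> B u"
      by (metis sym inner_commute)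
    then have "- ((v + u) \<bullet> B (v + u)) / 2 + (v \<bullet> B (v + u) - v \<bullet> B v / 2) = - (u \<bullet> B u) / 2"
      by (simp add: linear_add[OF linear_B] inner_add_left inner_add_right field_simps)
    then have "exp (- ((v + u) \<bullet> B (v + u)) / 2) * exp (v \<bullet> B (v + u) - v \<bullet> B v / 2) = exp (- (u \<bullet> B u) / 2)"
      by (simp flip: exp_add)
    then show "Z * exp (- ((v + u) \<bullet> B (v + u)) / 2) * (exp (v \<bullet> B (v + u) - v \<bullet> B v / 2) * p (v + u)) =
        Z * exp (- (u \<bullet> B u) / 2) * p (u + v)"
      by (simp add: mult.assoc[symmetric] add.commute[of u v])
  qed
  also have "\<dots> = (\<integral>u. p (u + v) \<partial>\<gamma>)"
    by (simp add: integral_gauss)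
  finally show ?thesis ..
qed

text \<open>Gaussian integration by parts: both sides are the derivative at \<open>s = 0\<close> of
  \<open>\<integral> f (w + \<mu> (u + s v)) \<partial>\<gamma>\<close>, computed before and after translating Lebesgue measure by \<open>s v\<close>.\<close>

lemma stein: "(\<integral>u. f (w + \<mu> *\<^sub>R u) * (v \<bullet> B u) \<partial>\<gamma>) = \<mu> * (v \<bullet> smoothed_grad w)"
proof -
  define p where "p u = f (w + \<mu> *\<^sub>R u)" for u
  define X where "X = \<mu> * (v \<bullet> smoothed_grad w)"
  define Y where "Y = (\<integral>u. p u * (v \<bullet> B u) \<partial>\<gamma>)"
  \<comment> \<open>\<open>s * y u\<close> bounds the exponent of the translation density for
    \<open>0 < s \<le> 1\<close>, so one integrable function of \<open>y\<close> controls the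
    remainders for all such \<open>s\<close>.\<close>
  define y where "y u = norm (B v) * norm u + v \<bullet> B v" for u :: 'a
  have [measurable]: "p \<in> borel_measurable borel" "y \<in> borel_measurable borel"
    unfolding p_def[abs_def] y_def[abs_def] by measurable
  define a where "a = \<bar>f w\<bar> + norm (g w) + L1 * hi"
  have p_le: "\<bar>p u\<bar> \<le> a * exp (2 * \<mu> * norm u)" for u
    unfolding p_def a_def by (rule f_le_exp)
  have a: "a \<ge> 0"
    using L1_pos hi_pos by (simp add: a_def)
  have alpha: "\<bar>v \<bullet> B u\<bar> \<le> norm (B v) * norm u" for u
    using Cauchy_Schwarz_ineq2[of "B v" u] by (simp add: sym)
  have y_nonneg: "0 \<le> y u" for u
    by (simp add: y_def B_nonneg)
  have int_p: "integrable \<gamma> p"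
    unfolding p_def[abs_def] by (rule integrable_f)
  have int_K: "integrable \<gamma> (\<lambda>u. 3 * exp (2 * y u) * \<bar>p u\<bar>)"
  proof (rule integrable_exp_bound)
    fix u
    have "norm (3 * exp (2 * y u) * \<bar>p u\<bar>) \<le> 3 * exp (2 * y u) * (a * exp (2 * \<mu> * norm u))"
      using p_le[of u] by (simp add: abs_mult)
    also have "\<dots> = 3 * a * exp (2 * (v \<bullet> B v)) * exp ((2 * norm (B v) + 2 * \<mu>) * norm u)"
      by (simp add: y_def distrib_left distrib_right exp_add mult_ac)
    finally show "norm (3 * exp (2 * y u) * \<bar>p u\<bar>) \<le> \<dots>" .
  qed simp
  have int_Y: "integrable \<gamma> (\<lambda>u. p u * (v \<bullet> B u))"
  proof (rule Bochner_Integration.integrable_bound[OF int_K])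
    show "AE u in \<gamma>. norm (p u * (v \<bullet> B u)) \<le> norm (3 * exp (2 * y u) * \<bar>p u\<bar>)"
    proof (rule AE_I2)
      fix u
      have "\<bar>v \<bullet> B u\<bar> \<le> y u"
        using alpha[of u] B_nonneg[of v] by (simp add: y_def)
      also have "y u \<le> 3 * exp (2 * y u)"
        using exp_ge_add_one_self[of "2 * y u"] y_nonneg[of u] by linarith
      finally show "norm (p u * (v \<bullet> B u)) \<le> norm (3 * exp (2 * y u) * \<bar>p u\<bar>)"
        by (simp add: abs_mult mult.commute[of "\<bar>p u\<bar>"] mult_right_mono)
    qed
  qed simp
  define I where "I = (\<integral>u. 3 * exp (2 * y u) * \<bar>p u\<bar> \<partial>\<gamma>)"
  have shifted: "p (u + s *\<^sub>R v) = f ((w + \<mu> *\<^sub>R u) + (s * \<mu>) *\<^sub>R v)" for u s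
    by (simp add: p_def algebra_simps)
  \<comment> \<open>Expansion through the translated argument of \<open>f\<close>: the linear
    coefficient is \<open>X\<close>, with an error quadratic in \<open>s\<close>.\<close>
  have lhs: "\<bar>(\<integral>u. p (u + s *\<^sub>R v) \<partial>\<gamma>) - (\<integral>u. p u \<partial>\<gamma>) - s * X\<bar> \<le> s\<^sup>2 * (L1 * hi * (\<mu> * norm v)\<^sup>2)" for s
  proof -
    have int: "integrable \<gamma> (\<lambda>u. p (u + s *\<^sub>R v))"
      using integrable_f[of "w + (s * \<mu>) *\<^sub>R v"] by (simp add: p_def algebra_simps)
    have "(\<integral>u. p (u + s *\<^sub>R v) \<partial>\<gamma>) - (\<integral>u. p u \<partial>\<gamma>) - s * X =
        (\<integral>u. p (u + s *\<^sub>R v) - p u - ((s * \<mu>) *\<^sub>R v) \<bullet> g (w + \<mu> *\<^sub>R u) \<partial>\<gamma>)"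
      using int int_p integrable_g[of w] by (simp add: X_def smoothed_grad_def)
    also have "\<bar>\<dots>\<bar> \<le> (\<integral>u. L1 * hi * (norm ((s * \<mu>) *\<^sub>R v))\<^sup>2 \<partial>\<gamma>)"
    proof (rule integral_abs_bound[THEN order_trans], rule integral_mono)
      show "integrable \<gamma> (\<lambda>u. \<bar>p (u + s *\<^sub>R v) - p u - ((s * \<mu>) *\<^sub>R v) \<bullet> g (w + \<mu> *\<^sub>R u)\<bar>)"
        using int int_p integrable_g[of w] by simp
      show "\<bar>p (u + s *\<^sub>R v) - p u - ((s * \<mu>) *\<^sub>R v) \<bullet> g (w + \<mu> *\<^sub>R u)\<bar>
          \<le> L1 * hi * (norm ((s * \<mu>) *\<^sub>R v))\<^sup>2" for u
        unfolding shifted unfolding p_def by (rule taylor)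
    qed simp
    finally show ?thesis
      using gauss.prob_space by (simp add: power_mult_distrib mult_ac)
  qed
  \<comment> \<open>Expansion through the translation density: the linear coefficient is
    \<open>Y\<close>. Two quadratic errors force \<open>X = Y\<close> as \<open>s\<close> tends to
    0.\<close>
  have rhs: "\<bar>(\<integral>u. p (u + s *\<^sub>R v) \<partial>\<gamma>) - (\<integral>u. p u \<partial>\<gamma>) - s * Y\<bar> \<le> s\<^sup>2 * I"
    if s: "0 < s" "s \<le> 1" for s
  proof -
    define W where "W u = exp (s * (v \<bullet> B u) - s\<^sup>2 * (v \<bullet> B v) / 2)" for u
    have [measurable]: "W \<in> borel_measurable borel"
      unfolding W_def[abs_def] by measurable
    \<comment> \<open>The factor 3 is 2 + 1: the exponential remainder contributes 2 through
      \<open>(y u)\<^sup>2 \<le> 2 * exp (y u)\<close>, and the second-order part of the exponent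
      contributes 1.\<close>
    have W_bound: "\<bar>W u - 1 - s * (v \<bullet> B u)\<bar> \<le> s\<^sup>2 * (3 * exp (2 * y u))" for u
    proof -
      define x where "x = s * (v \<bullet> B u) - s\<^sup>2 * (v \<bullet> B v) / 2"
      have "\<bar>x\<bar> \<le> s * \<bar>v \<bullet> B u\<bar> + s\<^sup>2 * (v \<bullet> B v) / 2"
        using s B_nonneg[of v] unfolding x_def by (simp add: abs_mult order_trans[OF abs_triangle_ineq4])
      also have "\<dots> \<le> s * (norm (B v) * norm u) + s * (v \<bullet> B v)"
      proof (intro add_mono mult_left_mono alpha)
        have "s\<^sup>2 * (v \<bullet> B v) \<le> s * (v \<bullet> B v)"
          using s B_nonneg[of v] by (intro mult_right_mono) (auto simp: power2_eq_square mult_left_le)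
        moreover have "0 \<le> s * (v \<bullet> B v)"
          using s B_nonneg[of v] by simp
        ultimately show "s\<^sup>2 * (v \<bullet> B v) / 2 \<le> s * (v \<bullet> B v)"
          by linarith
      qed (use s in auto)
      finally have x1: "\<bar>x\<bar> \<le> s * y u"
        by (simp add: y_def distrib_left)
      then have x2: "\<bar>x\<bar> \<le> y u"
        using s y_nonneg[of u] mult_right_mono[of s 1 "y u"] by linarith
      have e: "y u \<le> exp (y u)" "1 \<le> exp (y u)"
        using exp_ge_add_one_self[of "y u"] y_nonneg[of u] by (linarith, simp)
      have y2: "(y u)\<^sup>2 \<le> 2 * exp (y u)"
        using exp_lower_Taylor_quadratic[OF y_nonneg[of u]] y_nonneg[of u] by simp
      have "\<bar>exp x - 1 - x\<bar> \<le> x\<^sup>2 * exp \<bar>x\<bar>"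
        by (rule abs_exp_taylor2_le)
      also have "\<dots> \<le> (s * y u)\<^sup>2 * exp (y u)"
        using x1 x2 power_mono[OF x1, of 2] by (intro mult_mono) auto
      also have "\<dots> = s\<^sup>2 * ((y u)\<^sup>2 * exp (y u))"
        by (simp add: power_mult_distrib)
      also have "\<dots> \<le> s\<^sup>2 * (2 * exp (y u) * exp (y u))"
        using y2 by (intro mult_left_mono mult_right_mono) auto
      finally have 1: "\<bar>exp x - 1 - x\<bar> \<le> s\<^sup>2 * (2 * exp (2 * y u))"
        by (simp add: exp_double power2_eq_square mult.assoc)
      have "v \<bullet> B v / 2 \<le> y u"
        using B_nonneg[of v] by (simp add: y_def add_increasing)
      also have "y u \<le> exp (2 * y u)"
        using e(1) y_nonneg[of u] by (rule_tac order_trans[OF e(1)]) simp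
      finally have 2: "s\<^sup>2 * (v \<bullet> B v / 2) \<le> s\<^sup>2 * exp (2 * y u)"
        by (rule mult_left_mono) simp
      have "W u - 1 - s * (v \<bullet> B u) = (exp x - 1 - x) - s\<^sup>2 * (v \<bullet> B v / 2)"
        by (simp add: W_def x_def)
      then have "\<bar>W u - 1 - s * (v \<bullet> B u)\<bar> \<le> \<bar>exp x - 1 - x\<bar> + s\<^sup>2 * (v \<bullet> B v / 2)"
        using mult_nonneg_nonneg[OF zero_le_power2[of s] B_nonneg[of v]] by linarith
      with 1 2 show ?thesis by linarith
    qed
    have K_bound: "norm ((W u - 1 - s * (v \<bullet> B u)) * p u) \<le> s\<^sup>2 * (3 * exp (2 * y u) * \<bar>p u\<bar>)" for u
      using mult_right_mono[OF W_bound[of u], of "\<bar>p u\<bar>"] by (simp add: abs_mult mult.assoc)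
    have int_W: "integrable \<gamma> (\<lambda>u. (W u - 1 - s * (v \<bullet> B u)) * p u)"
      using K_bound
      by (intro Bochner_Integration.integrable_bound[OF integrable_mult_right[OF int_K, of "s\<^sup>2"]])
         (auto intro: order_trans[OF _ abs_ge_self])
    have "W u * p u = (W u - 1 - s * (v \<bullet> B u)) * p u + p u + s * (p u * (v \<bullet> B u))" for u
      by (simp add: algebra_simps)
    moreover have "(\<integral>u. p (u + s *\<^sub>R v) \<partial>\<gamma>) = (\<integral>u. W u * p u \<partial>\<gamma>)"
      by (simp add: integral_shift W_def B_scaleR power2_eq_square mult.assoc)
    ultimately have "(\<integral>u. p (u + s *\<^sub>R v) \<partial>\<gamma>) - (\<integral>u. p u \<partial>\<gamma>) - s * Y =
        (\<integral>u. (W u - 1 - s * (v \<bullet> B u)) * p u \<partial>\<gamma>)"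
      using int_W int_p int_Y by (simp add: Y_def)
    also have "\<bar>\<dots>\<bar> \<le> (\<integral>u. s\<^sup>2 * (3 * exp (2 * y u) * \<bar>p u\<bar>) \<partial>\<gamma>)"
      using int_W int_K K_bound
      by (intro integral_abs_bound[THEN order_trans] integral_mono) auto
    finally show ?thesis
      by (simp add: I_def)
  qed
  define C where "C = L1 * hi * (\<mu> * norm v)\<^sup>2 + I"
  have C: "\<bar>X - Y\<bar> \<le> s * C" if s: "0 < s" "s \<le> 1" for s
  proof -
    have "\<bar>s * X - s * Y\<bar> \<le> s\<^sup>2 * (L1 * hi * (\<mu> * norm v)\<^sup>2) + s\<^sup>2 * I"
      using lhs[of s] rhs[OF s] by linarith
    moreover have "\<bar>s * X - s * Y\<bar> = s * \<bar>X - Y\<bar>"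
      using s by (simp add: abs_mult flip: right_diff_distrib)
    ultimately have "s * \<bar>X - Y\<bar> \<le> s * (s * C)"
      by (simp add: C_def power2_eq_square algebra_simps)
    then show ?thesis
      using s by simp
  qed
  have "X = Y"
  proof (rule ccontr)
    assume "X \<noteq> Y"
    \<comment> \<open>Small enough that \<open>s * C\<close> is at most half of the gap; the added 1
      covers \<open>C = 0\<close>.\<close>
    define s where "s = min 1 (\<bar>X - Y\<bar> / (2 * (\<bar>C\<bar> + 1)))"
    have s: "0 < s" "s \<le> 1"
      using \<open>X \<noteq> Y\<close> by (auto simp: s_def)
    have "s * C \<le> s * (\<bar>C\<bar> + 1)"
      using s by (intro mult_left_mono) auto
    also have "\<dots> \<le> \<bar>X - Y\<bar> / (2 * (\<bar>C\<bar> + 1)) * (\<bar>C\<bar> + 1)"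
      by (intro mult_right_mono) (auto simp: s_def)
    also have "\<dots> = \<bar>X - Y\<bar> / 2"
      by (simp add: field_simps)
    finally have "\<bar>X - Y\<bar> \<le> \<bar>X - Y\<bar> / 2"
      by (rule order_trans[OF C[OF s]])
    with \<open>X \<noteq> Y\<close> show False by simp
  qed
  then show ?thesis
    by (simp add: X_def Y_def p_def)
qed

section \<open>Mean and variance of the oracle\<close>

lemma B_bound: obtains K where "0 < K" "\<And>u. norm (B u) \<le> K * exp (norm u)"
proof -
  obtain K where K: "K > 0" "\<And>u. norm (B u) \<le> norm u * K"
    using bounded_linear.pos_bounded[OF bounded_linear_B] by blast
  have "norm (B u) \<le> K * exp (norm u)" for u
    using K(2)[of u] mult_right_mono[OF norm_le_exp[of u], of K] K(1)
    by (subst mult.commute) linarith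
  with K(1) show ?thesis by (rule that)
qed

lemma estimator_le_exp:
  obtains C where "\<And>u. norm (estimator w u) \<le> C * exp ((2 * \<mu> + 1) * norm u)"
proof -
  obtain K where K: "K > 0" "\<And>u. norm (B u) \<le> K * exp (norm u)"
    by (rule B_bound) blast
  define a where "a = \<bar>f w\<bar> + norm (g w) + L1 * hi"
  have a: "\<bar>f w\<bar> \<le> a" "0 \<le> a"
    using L1_pos hi_pos by (simp_all add: a_def)
  have "norm (estimator w u) \<le> 2 * a / \<mu> * K * exp ((2 * \<mu> + 1) * norm u)" for u
  proof -
    have "\<bar>f w\<bar> \<le> a * exp (2 * \<mu> * norm u)"
      using a mu_pos mult_left_mono[of 1 "exp (2 * \<mu> * norm u)" a] by simp
    then have "\<bar>f (w + \<mu> *\<^sub>R u) - f w\<bar> \<le> 2 * a * exp (2 * \<mu> * norm u)"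
      using f_le_exp[of w u] by (simp add: a_def[symmetric])
    then have "\<bar>(f (w + \<mu> *\<^sub>R u) - f w) / \<mu>\<bar> \<le> 2 * a * exp (2 * \<mu> * norm u) / \<mu>"
      using mu_pos by (simp add: divide_right_mono)
    then have "norm (estimator w u) \<le> 2 * a * exp (2 * \<mu> * norm u) / \<mu> * (K * exp (norm u))"
      unfolding estimator_def norm_scaleR norm_S using K(2)[of u] a mu_pos
      by (intro mult_mono) auto
    also have "\<dots> = 2 * a / \<mu> * K * exp ((2 * \<mu> + 1) * norm u)"
      by (simp add: distrib_right exp_add)
    finally show ?thesis .
  qed
  then show ?thesis by (rule that)
qed

lemma measurable_estimator [measurable]: "estimator w \<in> borel_measurable borel"
  unfolding estimator_def[abs_def] by measurable

lemma measurable_estimator2: "(\<lambda>(w, u). estimator w u) \<in> borel_measurable (borel \<Otimes>\<^sub>M borel)"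
  unfolding estimator_def[abs_def] by measurable

lemma integrable_estimator: "integrable \<gamma> (estimator w)"
proof -
  obtain C where "\<And>u. norm (estimator w u) \<le> C * exp ((2 * \<mu> + 1) * norm u)"
    using estimator_le_exp[of w] by blast
  then show ?thesis
    by (intro integrable_exp_bound) simp_all
qed

lemma integrable_estimator_sq: "integrable \<gamma> (\<lambda>u. (norm (estimator w u - c))\<^sup>2)"
proof -
  obtain C where C: "\<And>u. norm (estimator w u) \<le> C * exp ((2 * \<mu> + 1) * norm u)"
    using estimator_le_exp[of w] by blast
  have "norm ((norm (estimator w u - c))\<^sup>2) \<le> (C + norm c)\<^sup>2 * exp ((2 * (2 * \<mu> + 1)) * norm u)" for u
  proof -
    have "norm (estimator w u - c) \<le> norm (estimator w u) + norm c"
      by (rule norm_triangle_ineq4)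
    also have "norm c \<le> norm c * exp ((2 * \<mu> + 1) * norm u)"
      using mu_pos mult_left_mono[of 1 "exp ((2 * \<mu> + 1) * norm u)" "norm c"] by simp
    finally have "norm (estimator w u - c) \<le> (C + norm c) * exp ((2 * \<mu> + 1) * norm u)"
      using C[of u] by (simp add: distrib_right)
    then have "(norm (estimator w u - c))\<^sup>2 \<le> ((C + norm c) * exp ((2 * \<mu> + 1) * norm u))\<^sup>2"
      by (rule power_mono) simp
    also have "\<dots> = (C + norm c)\<^sup>2 * exp ((2 * (2 * \<mu> + 1)) * norm u)"
      by (simp only: power_mult_distrib exp_double mult.assoc)
    finally show ?thesis by simp
  qed
  then show ?thesis
    by (intro integrable_exp_bound) simp_all
qed

text \<open>\<open>stein\<close>, tested against every vector, identifies the mean of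
  \<open>f (w + \<mu> *\<^sub>R u) *\<^sub>R B u\<close> as \<open>\<mu>\<close> times the smoothed
  gradient. Subtracting \<open>f w\<close> leaves the mean unchanged because \<open>B u\<close> is
  centred.\<close>

lemma estimator_mean: "(\<integral>u. estimator w u \<partial>\<gamma>) = F\<mu> w"
proof -
  obtain K where K: "K > 0" "\<And>u. norm (B u) \<le> K * exp (norm u)"
    by (rule B_bound) blast
  have int_B: "integrable \<gamma> B"
    using K by (intro integrable_exp_bound[where C = K and a = 1]) simp_all
  have "(\<integral>u. B u \<partial>\<gamma>) = B (\<integral>u. u \<partial>\<gamma>)"
    by (rule integral_bounded_linear[OF bounded_linear_B integrable_id])
  then have mean_B: "(\<integral>u. B u \<partial>\<gamma>) = 0"
    by (simp add: integral_id linear_0[OF linear_B])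
  have f_eq: "f (w + \<mu> *\<^sub>R u) *\<^sub>R B u = \<mu> *\<^sub>R S (estimator w u) + f w *\<^sub>R B u" for u
    using mu_pos
    by (simp add: estimator_def linear_scale[OF linear_S]) (simp add: algebra_simps)
  have int_S: "integrable \<gamma> (\<lambda>u. S (estimator w u))"
    using integrable_bounded_linear[OF bounded_linear_S integrable_estimator] .
  then have int: "integrable \<gamma> (\<lambda>u. f (w + \<mu> *\<^sub>R u) *\<^sub>R B u)"
    using int_B by (simp add: f_eq)
  have "x \<bullet> (\<integral>u. f (w + \<mu> *\<^sub>R u) *\<^sub>R B u \<partial>\<gamma>) = x \<bullet> (\<mu> *\<^sub>R smoothed_grad w)" for x
    using stein[of w x] int by (simp flip: integral_inner_right)
  then have "(\<integral>u. f (w + \<mu> *\<^sub>R u) *\<^sub>R B u \<partial>\<gamma>) = \<mu> *\<^sub>R smoothed_grad w"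
    using vector_eq_ldot by blast
  then have "\<mu> *\<^sub>R (\<integral>u. S (estimator w u) \<partial>\<gamma>) = \<mu> *\<^sub>R smoothed_grad w"
    using int_S int_B by (simp add: f_eq mean_B)
  then have "S (\<integral>u. estimator w u \<partial>\<gamma>) = smoothed_grad w"
    using mu_pos integral_bounded_linear[OF bounded_linear_S integrable_estimator, of w] by simp
  then show ?thesis
    by (metis F\<mu>_def S_S)
qed

lemma estimator_variance_le:
  assumes "(\<integral>u. (estimator w u - F\<mu> w) \<bullet> A (estimator w u - F\<mu> w) \<partial>\<gamma>) \<le> v"
  shows "(\<integral>u. (norm (estimator w u - F\<mu> w))\<^sup>2 \<partial>\<gamma>) \<le> hi * v"
proof -
  define e where "e u = estimator w u - F\<mu> w" for u
  have [measurable]: "e \<in> borel_measurable borel"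
    unfolding e_def[abs_def] by measurable
  have sq: "integrable \<gamma> (\<lambda>u. (norm (e u))\<^sup>2)"
    unfolding e_def by (rule integrable_estimator_sq)
  have le: "e u \<bullet> A (e u) \<le> (norm (e u))\<^sup>2 / lo" for u
    using dual_le_norm[of "e u"] lo_pos by (simp add: power2_norm_eq_inner field_simps)
  \<comment> \<open>Without this the assumed bound could hold merely because the integral defaults
    to 0.\<close>
  have dual: "integrable \<gamma> (\<lambda>u. e u \<bullet> A (e u))"
  proof (rule Bochner_Integration.integrable_bound[OF integrable_divide_zero[OF sq, of lo]])
    show "AE u in \<gamma>. norm (e u \<bullet> A (e u)) \<le> norm ((norm (e u))\<^sup>2 / lo)"
      using le A_nonneg lo_pos by simp
  qed simp
  have "(\<integral>u. (norm (e u))\<^sup>2 \<partial>\<gamma>) \<le> (\<integral>u. hi * (e u \<bullet> A (e u)) \<partial>\<gamma>)"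
    using sq dual norm_le_dual by (intro integral_mono) (auto simp: power2_norm_eq_inner)
  also have "\<dots> \<le> hi * v"
    using assms hi_pos by (simp add: e_def)
  finally show ?thesis
    by (simp add: e_def)
qed

lemma F\<mu>_lipschitz: "norm (F\<mu> w - F\<mu> w') \<le> L1 * hi * norm (w - w')"
proof -
  have "norm (F\<mu> w - F\<mu> w') = norm (\<integral>u. g (w + \<mu> *\<^sub>R u) - g (w' + \<mu> *\<^sub>R u) \<partial>\<gamma>)"
    using integrable_g[of w] integrable_g[of w']
    by (simp add: F\<mu>_def smoothed_grad_def flip: S_diff)
  also have "\<dots> \<le> (\<integral>u. norm (g (w + \<mu> *\<^sub>R u) - g (w' + \<mu> *\<^sub>R u)) \<partial>\<gamma>)"
    by (rule integral_norm_bound)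
  also have "\<dots> \<le> (\<integral>u. L1 * hi * norm (w - w') \<partial>\<gamma>)"
  proof (rule integral_mono)
    show "norm (g (w + \<mu> *\<^sub>R u) - g (w' + \<mu> *\<^sub>R u)) \<le> L1 * hi * norm (w - w')" for u
      using lipschitz[of "w + \<mu> *\<^sub>R u" "w' + \<mu> *\<^sub>R u"] by simp
  qed (use integrable_g[of w] integrable_g[of w'] in simp_all)
  finally show ?thesis
    using gauss.prob_space by simp
qed

lemma smoothed_minty:
  assumes minty: "\<And>w. 0 \<le> F w \<bullet> (w - z) + \<rho> / 2 * (F w \<bullet> A (F w))" and rho: "0 \<le> \<rho>"
  shows "0 \<le> F\<mu> w \<bullet> (w - z) + \<rho> / 2 * (F\<mu> w \<bullet> A (F\<mu> w))
    + (\<mu>\<^sup>2 * L1 * DIM('a) + \<rho> / 2 * (L1\<^sup>2 * \<mu>\<^sup>2 * DIM('a)))"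
proof -
  define q where "q u = u \<bullet> B u" for u
  define X where "X u = F (w + \<mu> *\<^sub>R u)" for u
  \<comment> \<open>The Lipschitz bound compares \<open>X u\<close> with \<open>F w\<close>, not
    with the mean \<open>m\<close>. Expanding around \<open>c\<close> bounds the squared dual norm
    by an expression affine in \<open>X u\<close> and \<open>q u\<close>, so only first moments have
    to be integrated.\<close>
  define c where "c = F w"
  define m where "m = F\<mu> w"
  have X_diff: "(X u - c) \<bullet> A (X u - c) \<le> L1\<^sup>2 * \<mu>\<^sup>2 * q u" for u
  proof -
    have "(X u - c) \<bullet> A (X u - c) =
        (g (w + \<mu> *\<^sub>R u) - g w) \<bullet> A (g (w + \<mu> *\<^sub>R u) - g w)"
      by (simp add: X_def c_def F_def A_S flip: S_diff)
    also have "\<dots> \<le> L1\<^sup>2 * ((\<mu> *\<^sub>R u) \<bullet> B (\<mu> *\<^sub>R u))"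
      using dual_lipschitz_sq[of "w + \<mu> *\<^sub>R u" w] by simp
    finally show ?thesis
      by (simp add: q_def B_scaleR power2_eq_square mult_ac)
  qed
  have pair: "(X u - c) \<bullet> u \<le> L1 * \<mu> * q u" for u
  proof -
    have "(X u - c) \<bullet> u \<le> sqrt ((X u - c) \<bullet> A (X u - c)) * sqrt (q u)"
      unfolding q_def by (rule dual_pairing)
    also have "\<dots> \<le> sqrt (L1\<^sup>2 * \<mu>\<^sup>2 * q u) * sqrt (q u)"
      using X_diff B_nonneg by (intro mult_right_mono) (auto simp: q_def)
    also have "\<dots> = L1 * \<mu> * (sqrt (q u) * sqrt (q u))"
      using L1_pos mu_pos by (simp add: real_sqrt_mult)
    also have "sqrt (q u) * sqrt (q u) = q u"
      by (simp add: q_def B_nonneg)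
    finally show ?thesis .
  qed
  have A_diff: "(x - y) \<bullet> A (x - y) = x \<bullet> A x - 2 * (x \<bullet> A y) + y \<bullet> A y" for x y
    by (simp add: linear_diff[OF linear_A] inner_diff_left inner_diff_right sym_A[of y x]
        inner_commute[of "A y" x])
  have pointwise: "0 \<le> X u \<bullet> (w - z) + \<mu> * (c \<bullet> u) + \<mu>\<^sup>2 * L1 * q u
      + \<rho> / 2 * (L1\<^sup>2 * \<mu>\<^sup>2 * q u + 2 * (X u \<bullet> A c) - c \<bullet> A c)" for u
  proof -
    have "X u \<bullet> A (X u) \<le> L1\<^sup>2 * \<mu>\<^sup>2 * q u + 2 * (X u \<bullet> A c) - c \<bullet> A c"
      using X_diff[of u] A_diff[of "X u" c] by linarith
    then have 1: "\<rho> / 2 * (X u \<bullet> A (X u)) \<le> \<rho> / 2 * (L1\<^sup>2 * \<mu>\<^sup>2 * q u + 2 * (X u \<bullet> A c) - c \<bullet> A c)"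
      using rho by (intro mult_left_mono) auto
    have "\<mu> * ((X u - c) \<bullet> u) \<le> \<mu> * (L1 * \<mu> * q u)"
      using mu_pos by (intro mult_left_mono pair) auto
    then have 2: "\<mu> * (X u \<bullet> u) \<le> \<mu> * (c \<bullet> u) + \<mu>\<^sup>2 * L1 * q u"
      by (simp add: inner_diff_left algebra_simps power2_eq_square)
    have "0 \<le> X u \<bullet> (w + \<mu> *\<^sub>R u - z) + \<rho> / 2 * (X u \<bullet> A (X u))"
      using minty[of "w + \<mu> *\<^sub>R u"] by (simp add: X_def)
    moreover have "X u \<bullet> (w + \<mu> *\<^sub>R u - z) = X u \<bullet> (w - z) + \<mu> * (X u \<bullet> u)"
      by (simp add: inner_diff_right inner_add_right)
    ultimately show ?thesis
      using 1 2 by linarith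
  qed
  have int_X: "integrable \<gamma> X" and mean_X: "(\<integral>u. X u \<partial>\<gamma>) = m"
    unfolding X_def F_def m_def F\<mu>_def smoothed_grad_def
    by (rule integrable_bounded_linear[OF bounded_linear_S integrable_g])
       (rule integral_bounded_linear[OF bounded_linear_S integrable_g])
  have int_q: "integrable \<gamma> q"
    unfolding q_def[abs_def] by (rule integrable_form)
  define Q where "Q = (\<integral>u. q u \<partial>\<gamma>)"
  have Q_le: "Q \<le> DIM('a)"
    unfolding Q_def q_def by (rule integral_form_le)
  have "0 \<le> (\<integral>u. X u \<bullet> (w - z) + \<mu> * (c \<bullet> u) + \<mu>\<^sup>2 * L1 * q u
      + \<rho> / 2 * (L1\<^sup>2 * \<mu>\<^sup>2 * q u + 2 * (X u \<bullet> A c) - c \<bullet> A c) \<partial>\<gamma>)"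
    by (rule Bochner_Integration.integral_nonneg) (rule pointwise)
  also have "\<dots> = m \<bullet> (w - z) + \<mu>\<^sup>2 * L1 * Q
      + \<rho> / 2 * (L1\<^sup>2 * \<mu>\<^sup>2 * Q + 2 * (m \<bullet> A c) - c \<bullet> A c)"
    using int_X int_q integrable_id gauss.prob_space by (simp add: mean_X integral_id Q_def)
  also have "\<dots> \<le> m \<bullet> (w - z) + \<mu>\<^sup>2 * L1 * DIM('a)
      + \<rho> / 2 * (L1\<^sup>2 * \<mu>\<^sup>2 * DIM('a) + m \<bullet> A m)"
  proof (intro add_mono mult_left_mono order_refl Q_le)
    \<comment> \<open>Replacing \<open>c\<close> by the mean costs nothing: the difference of the
      two sides is the dual form at \<open>m - c\<close>.\<close>
    have "2 * (m \<bullet> A c) - c \<bullet> A c \<le> m \<bullet> A m"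
      using A_nonneg[of "m - c"] A_diff[of m c] by linarith
    moreover have "L1\<^sup>2 * \<mu>\<^sup>2 * Q \<le> L1\<^sup>2 * \<mu>\<^sup>2 * DIM('a)"
      by (intro mult_left_mono Q_le) simp
    ultimately show "L1\<^sup>2 * \<mu>\<^sup>2 * Q + 2 * (m \<bullet> A c) - c \<bullet> A c \<le> L1\<^sup>2 * \<mu>\<^sup>2 * DIM('a) + m \<bullet> A m"
      by linarith
  qed (use L1_pos rho in auto)
  finally show ?thesis
    by (simp add: m_def algebra_simps)
qed

end

section \<open>Batches of independent samples\<close>

locale iid_samples = prob_space M for M :: "'w measure" +
  fixes X :: "'i \<Rightarrow> 'w \<Rightarrow> 'a::euclidean_space" and I :: "'i set" and \<gamma> :: "'a measure"
  assumes indep: "indep_vars (\<lambda>_. borel) X I"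
    and distr_X: "\<And>i. i \<in> I \<Longrightarrow> distr M borel (X i) = \<gamma>"
    and prob_\<gamma>: "prob_space \<gamma>" and sets_\<gamma> [measurable_cong, simp]: "sets \<gamma> = sets borel"
begin

sublocale \<gamma>: prob_space \<gamma>
  by (rule prob_\<gamma>)

lemma space_\<gamma> [simp]: "space \<gamma> = UNIV"
  using sets_eq_imp_space_eq[OF sets_\<gamma>] by simp

text \<open>Measurability with respect to the samples indexed by \<open>J\<close>, in the factorised
  form of the Doob-Dynkin lemma. An explicit factor lets independence of index blocks pass to
  anything computed from a block.\<close>

definition determined :: "'i set \<Rightarrow> ('w \<Rightarrow> 'b::topological_space) \<Rightarrow> bool" where
  "determined J Y \<longleftrightarrow> (\<exists>h \<in> borel_measurable (PiM J (\<lambda>_. borel)). \<forall>\<omega> \<in> space M. Y \<omega> = h (\<lambda>i\<in>J. X i \<omega>))"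

lemma determined_mono:
  assumes "determined J Y" "J \<subseteq> J'"
  shows "determined J' Y"
proof -
  obtain h where h: "h \<in> borel_measurable (PiM J (\<lambda>_. borel))"
    "\<And>\<omega>. \<omega> \<in> space M \<Longrightarrow> Y \<omega> = h (\<lambda>i\<in>J. X i \<omega>)"
    using assms(1) unfolding determined_def by blast
  have "(\<lambda>x. h (restrict x J)) \<in> borel_measurable (PiM J' (\<lambda>_. borel))"
    using measurable_compose[OF measurable_restrict_subset[OF assms(2)] h(1)] .
  moreover have "restrict (\<lambda>i\<in>J'. X i \<omega>) J = (\<lambda>i\<in>J. X i \<omega>)" for \<omega>
    using assms(2) by (simp add: Int_absorb1)
  ultimately show ?thesis
    using h(2) unfolding determined_def by (intro bexI[where x = "\<lambda>x. h (restrict x J)"]) auto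
qed

lemma determined_compose2:
  fixes Y :: "'w \<Rightarrow> 'b::second_countable_topology" and Y' :: "'w \<Rightarrow> 'c::second_countable_topology"
  assumes "determined J Y" "determined J Y'"
    and F: "(\<lambda>(x, y). F x y) \<in> borel_measurable (borel \<Otimes>\<^sub>M borel)"
  shows "determined J (\<lambda>\<omega>. F (Y \<omega>) (Y' \<omega>))"
proof -
  obtain h h' where h: "h \<in> borel_measurable (PiM J (\<lambda>_. borel))" "h' \<in> borel_measurable (PiM J (\<lambda>_. borel))"
    "\<And>\<omega>. \<omega> \<in> space M \<Longrightarrow> Y \<omega> = h (\<lambda>i\<in>J. X i \<omega>)" "\<And>\<omega>. \<omega> \<in> space M \<Longrightarrow> Y' \<omega> = h' (\<lambda>i\<in>J. X i \<omega>)"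
    using assms(1,2) unfolding determined_def by blast
  have "(\<lambda>x. (case (h x, h' x) of (x, y) \<Rightarrow> F x y)) \<in> borel_measurable (PiM J (\<lambda>_. borel))"
    using h(1,2) F by (intro measurable_compose[OF measurable_Pair F])
  then show ?thesis
    using h(3,4) unfolding determined_def by (intro bexI[where x = "\<lambda>x. F (h x) (h' x)"]) auto
qed

lemma determined_compose:
  fixes Y :: "'w \<Rightarrow> 'b::second_countable_topology"
  assumes "determined J Y" and [measurable]: "F \<in> borel_measurable borel"
  shows "determined J (\<lambda>\<omega>. F (Y \<omega>))"
  by (rule determined_compose2[OF assms(1) assms(1), where F = "\<lambda>x _. F x"]) measurable

lemma determined_const: "determined J (\<lambda>_. c)"
  unfolding determined_def by (intro bexI[where x = "\<lambda>_. c"]) auto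

lemma determined_sample: "i \<in> J \<Longrightarrow> determined J (X i)"
  unfolding determined_def by (intro bexI[where x = "\<lambda>x. x i"]) auto

lemma determined_add:
  fixes Y :: "'w \<Rightarrow> 'b::euclidean_space"
  assumes "determined J Y" "determined J Y'"
  shows "determined J (\<lambda>\<omega>. Y \<omega> + Y' \<omega>)"
  using assms by (rule determined_compose2) measurable

lemma determined_diff:
  fixes Y :: "'w \<Rightarrow> 'b::euclidean_space"
  assumes "determined J Y" "determined J Y'"
  shows "determined J (\<lambda>\<omega>. Y \<omega> - Y' \<omega>)"
  using assms by (rule determined_compose2) measurable

lemma determined_scaleR:
  fixes Y :: "'w \<Rightarrow> 'b::euclidean_space"
  assumes "determined J Y"
  shows "determined J (\<lambda>\<omega>. c *\<^sub>R Y \<omega>)"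
  using assms by (rule determined_compose) measurable

lemma determined_sum:
  fixes Y :: "'k \<Rightarrow> 'w \<Rightarrow> 'b::euclidean_space"
  assumes "\<And>k. k \<in> K \<Longrightarrow> determined J (Y k)"
  shows "determined J (\<lambda>\<omega>. \<Sum>k\<in>K. Y k \<omega>)"
  using assms by (induction K rule: infinite_finite_induct) (auto intro: determined_const determined_add)

lemma determined_cong:
  assumes "\<And>\<omega>. \<omega> \<in> space M \<Longrightarrow> Y \<omega> = Y' \<omega>" "determined J Y'"
  shows "determined J Y"
  using assms unfolding determined_def by simp

lemma measurable_X: "i \<in> I \<Longrightarrow> X i \<in> borel_measurable M"
  using indep unfolding indep_vars_def by auto

lemma determined_measurable:
  assumes "determined J Y" "J \<subseteq> I"
  shows "Y \<in> borel_measurable M"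
proof -
  obtain h where h: "h \<in> borel_measurable (PiM J (\<lambda>_. borel))"
    "\<And>\<omega>. \<omega> \<in> space M \<Longrightarrow> Y \<omega> = h (\<lambda>i\<in>J. X i \<omega>)"
    using assms(1) unfolding determined_def by blast
  have "(\<lambda>\<omega>. \<lambda>i\<in>J. X i \<omega>) \<in> measurable M (PiM J (\<lambda>_. borel))"
    using assms(2) by (intro measurable_restrict measurable_X) auto
  from measurable_compose[OF this h(1)] show ?thesis
    using h(2) by (subst measurable_cong) auto
qed

text \<open>Disjoint blocks of an independent family are independent. The single sample is treated
  as the block \<open>{i}\<close>, and both blocks are pushed forward, by the factor
  \<open>h\<close> of \<open>Y\<close> and by the projection to \<open>i\<close>.\<close>

lemma distr_fresh:
  assumes "determined J Y" "J \<subseteq> I" "i \<in> I" "i \<notin> J"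
  shows "distr M (borel \<Otimes>\<^sub>M borel) (\<lambda>\<omega>. (Y \<omega>, X i \<omega>)) = distr M borel Y \<Otimes>\<^sub>M \<gamma>"
proof -
  obtain h where h: "h \<in> borel_measurable (PiM J (\<lambda>_. borel))"
    "\<And>\<omega>. \<omega> \<in> space M \<Longrightarrow> Y \<omega> = h (\<lambda>i\<in>J. X i \<omega>)"
    using assms(1) unfolding determined_def by blast
  define R where "R K = (\<lambda>\<omega>. \<lambda>j\<in>K. X j \<omega>)" for K
  define P where "P K = PiM K (\<lambda>_::'i. borel :: 'a measure)" for K
  have R: "R K \<in> measurable M (P K)" if "K \<subseteq> I" for K
    unfolding R_def P_def using that by (intro measurable_restrict measurable_X) auto
  have RJ: "R J \<in> measurable M (P J)" and Ri: "R {i} \<in> measurable M (P {i})"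
    using R assms(2,3) by auto
  have h': "h \<in> borel_measurable (P J)" and proj: "(\<lambda>x. x i) \<in> borel_measurable (P {i})"
    using h(1) by (simp_all add: P_def)
  have "indep_var (P J) (R J) (P {i}) (R {i})"
    unfolding P_def R_def using assms by (intro indep_var_restrict[OF indep]) auto
  then have prod: "distr M (P J) (R J) \<Otimes>\<^sub>M distr M (P {i}) (R {i}) =
      distr M (P J \<Otimes>\<^sub>M P {i}) (\<lambda>\<omega>. (R J \<omega>, R {i} \<omega>))"
    unfolding indep_var_distribution_eq by blast
  have Y_eq: "distr M borel Y = distr (distr M (P J) (R J)) borel h"
    using h(2) by (subst distr_distr[OF h' RJ]) (auto intro!: distr_cong simp: R_def)
  have X_eq: "\<gamma> = distr (distr M (P {i}) (R {i})) borel (\<lambda>x. x i)"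
    by (subst distr_distr[OF proj Ri]) (auto intro!: distr_cong simp: R_def distr_X[OF assms(3), symmetric])
  have "distr M borel Y \<Otimes>\<^sub>M \<gamma> =
      distr (distr M (P J) (R J)) borel h \<Otimes>\<^sub>M distr (distr M (P {i}) (R {i})) borel (\<lambda>x. x i)"
    by (simp only: Y_eq X_eq[symmetric])
  also have "\<dots> = distr (distr M (P J) (R J) \<Otimes>\<^sub>M distr M (P {i}) (R {i})) (borel \<Otimes>\<^sub>M borel) (\<lambda>(x, y). (h x, y i))"
    using h' proj \<gamma>.sigma_finite_measure_axioms
    by (intro pair_measure_distr) (simp_all add: X_eq[symmetric])
  also have "\<dots> = distr M (borel \<Otimes>\<^sub>M borel) ((\<lambda>(x, y). (h x, y i)) \<circ> (\<lambda>\<omega>. (R J \<omega>, R {i} \<omega>)))"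
    unfolding prod
  proof (rule distr_distr)
    note [measurable] = h' proj RJ Ri
    show "(\<lambda>(x, y). (h x, y i)) \<in> measurable (P J \<Otimes>\<^sub>M P {i}) (borel \<Otimes>\<^sub>M borel)"
      "(\<lambda>\<omega>. (R J \<omega>, R {i} \<omega>)) \<in> measurable M (P J \<Otimes>\<^sub>M P {i})"
      by measurable
  qed
  also have "\<dots> = distr M (borel \<Otimes>\<^sub>M borel) (\<lambda>\<omega>. (Y \<omega>, X i \<omega>))"
    using h(2) by (intro distr_cong) (auto simp: R_def)
  finally show ?thesis ..
qed

context
  fixes J i and Y :: "'w \<Rightarrow> 'b::second_countable_topology"
  assumes fresh: "determined J Y" "J \<subseteq> I" "i \<in> I" "i \<notin> J"
begin

lemma fresh_measurable:
  assumes [measurable]: "(\<lambda>(y, u). H y u) \<in> borel_measurable (borel \<Otimes>\<^sub>M borel)"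
  shows "(\<lambda>\<omega>. H (Y \<omega>) (X i \<omega>)) \<in> borel_measurable M"
proof -
  have [measurable]: "Y \<in> borel_measurable M" "X i \<in> borel_measurable M"
    using determined_measurable fresh measurable_X by auto
  show ?thesis by measurable
qed

text \<open>The tower property by Fubini: with the past value frozen at \<open>y\<close>, the
  integral over the fresh sample vanishes.\<close>

lemma fresh_integral_zero:
  fixes H :: "'b \<Rightarrow> 'a \<Rightarrow> real"
  assumes H [measurable]: "(\<lambda>(y, u). H y u) \<in> borel_measurable (borel \<Otimes>\<^sub>M borel)"
    and int: "integrable M (\<lambda>\<omega>. H (Y \<omega>) (X i \<omega>))"
    and zero: "\<And>y. (\<integral>u. H y u \<partial>\<gamma>) = 0"
  shows "(\<integral>\<omega>. H (Y \<omega>) (X i \<omega>) \<partial>M) = 0"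
proof -
  have Y [measurable]: "Y \<in> borel_measurable M" and Xi [measurable]: "X i \<in> borel_measurable M"
    using determined_measurable fresh measurable_X by auto
  interpret Y: prob_space "distr M borel Y"
    by (rule prob_space_distr) measurable
  interpret P: pair_prob_space "distr M borel Y" \<gamma> ..
  have "integrable (distr M (borel \<Otimes>\<^sub>M borel) (\<lambda>\<omega>. (Y \<omega>, X i \<omega>))) (\<lambda>(y, u). H y u)"
    by (subst integrable_distr_eq) (use int in simp_all)
  then have int': "integrable (distr M borel Y \<Otimes>\<^sub>M \<gamma>) (\<lambda>(y, u). H y u)"
    by (simp add: distr_fresh[OF fresh])
  have "(\<integral>\<omega>. H (Y \<omega>) (X i \<omega>) \<partial>M) = (\<integral>p. (\<lambda>(y, u). H y u) p \<partial>distr M (borel \<Otimes>\<^sub>M borel) (\<lambda>\<omega>. (Y \<omega>, X i \<omega>)))"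
    by (subst integral_distr) simp_all
  also have "\<dots> = (\<integral>y. (\<integral>u. H y u \<partial>\<gamma>) \<partial>distr M borel Y)"
    using P.integral_fst'[OF int'] by (simp add: distr_fresh[OF fresh])
  finally show ?thesis
    by (simp add: zero)
qed

text \<open>For a nonnegative integrand Tonelli applies first, so integrability over
  \<open>M\<close> comes out as a conclusion together with the bound.\<close>

lemma fresh_nonneg_integral_le:
  fixes H :: "'b \<Rightarrow> 'a \<Rightarrow> real"
  assumes H [measurable]: "(\<lambda>(y, u). H y u) \<in> borel_measurable (borel \<Otimes>\<^sub>M borel)"
    and nonneg: "\<And>y u. 0 \<le> H y u"
    and int: "\<And>y. integrable \<gamma> (H y)" and le: "\<And>y. (\<integral>u. H y u \<partial>\<gamma>) \<le> C"
  shows "integrable M (\<lambda>\<omega>. H (Y \<omega>) (X i \<omega>))" and "(\<integral>\<omega>. H (Y \<omega>) (X i \<omega>) \<partial>M) \<le> C"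
proof -
  have Y [measurable]: "Y \<in> borel_measurable M" and Xi [measurable]: "X i \<in> borel_measurable M"
    using determined_measurable fresh measurable_X by auto
  have C: "0 \<le> C"
    by (rule order_trans[OF _ le[of undefined]]) (simp add: Bochner_Integration.integral_nonneg nonneg)
  have "(\<integral>\<^sup>+\<omega>. ennreal (H (Y \<omega>) (X i \<omega>)) \<partial>M) =
      (\<integral>\<^sup>+p. (\<lambda>(y, u). ennreal (H y u)) p \<partial>distr M (borel \<Otimes>\<^sub>M borel) (\<lambda>\<omega>. (Y \<omega>, X i \<omega>)))"
    by (subst nn_integral_distr) simp_all
  also have "\<dots> = (\<integral>\<^sup>+y. (\<integral>\<^sup>+u. ennreal (H y u) \<partial>\<gamma>) \<partial>distr M borel Y)"
    unfolding distr_fresh[OF fresh] by (subst \<gamma>.nn_integral_fst[symmetric]) simp_all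
  also have "\<dots> \<le> (\<integral>\<^sup>+y. ennreal C \<partial>distr M borel Y)"
    using nonneg int le by (intro nn_integral_mono) (simp add: nn_integral_eq_integral ennreal_leI)
  also have "\<dots> = ennreal C"
    using emeasure_space_1 by (simp add: emeasure_distr)
  finally have nn: "(\<integral>\<^sup>+\<omega>. ennreal (H (Y \<omega>) (X i \<omega>)) \<partial>M) \<le> ennreal C" .
  show int: "integrable M (\<lambda>\<omega>. H (Y \<omega>) (X i \<omega>))"
    using nonneg nn by (intro integrableI_bounded fresh_measurable[OF H])
      (auto intro: le_less_trans)
  show "(\<integral>\<omega>. H (Y \<omega>) (X i \<omega>) \<partial>M) \<le> C"
    using nn C nonneg by (subst integral_eq_nn_integral) (auto intro!: enn2real_leI fresh_measurable[OF H])
qed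

end

section \<open>Square integrable random vectors\<close>

definition square_integrable :: "('w \<Rightarrow> 'a) \<Rightarrow> bool" where
  "square_integrable Y \<longleftrightarrow> Y \<in> borel_measurable M \<and> integrable M (\<lambda>\<omega>. (norm (Y \<omega>))\<^sup>2)"

lemma square_integrable_inner:
  assumes "square_integrable Y" "square_integrable Y'"
  shows "integrable M (\<lambda>\<omega>. Y \<omega> \<bullet> Y' \<omega>)"
proof (rule Bochner_Integration.integrable_bound)
  show "integrable M (\<lambda>\<omega>. (norm (Y \<omega>))\<^sup>2 + (norm (Y' \<omega>))\<^sup>2)"
    using assms by (auto simp: square_integrable_def)
  show "(\<lambda>\<omega>. Y \<omega> \<bullet> Y' \<omega>) \<in> borel_measurable M"
    using assms by (auto simp: square_integrable_def)
  have "norm (x \<bullet> y) \<le> norm ((norm x)\<^sup>2 + (norm y)\<^sup>2)" for x y :: 'a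
  proof -
    have "0 \<le> (norm x - norm y)\<^sup>2"
      by simp
    then have "2 * (norm x * norm y) \<le> (norm x)\<^sup>2 + (norm y)\<^sup>2"
      by (simp add: power2_diff)
    then show ?thesis
      using Cauchy_Schwarz_ineq2[of x y] mult_nonneg_nonneg[OF norm_ge_zero[of x] norm_ge_zero[of y]]
      by simp
  qed
  then show "AE \<omega> in M. norm (Y \<omega> \<bullet> Y' \<omega>) \<le> norm ((norm (Y \<omega>))\<^sup>2 + (norm (Y' \<omega>))\<^sup>2)"
    by simp
qed

lemma square_integrable_add:
  assumes "square_integrable Y" "square_integrable Y'"
  shows "square_integrable (\<lambda>\<omega>. Y \<omega> + Y' \<omega>)"
  unfolding square_integrable_def
proof
  show "(\<lambda>\<omega>. Y \<omega> + Y' \<omega>) \<in> borel_measurable M"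
    using assms by (auto simp: square_integrable_def)
  have "(norm (x + y))\<^sup>2 = (norm x)\<^sup>2 + 2 * (x \<bullet> y) + (norm y)\<^sup>2" for x y :: 'a
    by (simp add: power2_norm_eq_inner inner_add_left inner_add_right inner_commute)
  then show "integrable M (\<lambda>\<omega>. (norm (Y \<omega> + Y' \<omega>))\<^sup>2)"
    using assms square_integrable_inner[OF assms] by (simp add: square_integrable_def)
qed

lemma square_integrable_scaleR:
  assumes "square_integrable Y"
  shows "square_integrable (\<lambda>\<omega>. c *\<^sub>R Y \<omega>)"
  using assms by (auto simp: square_integrable_def power_mult_distrib intro!: borel_measurable_scaleR)

lemma square_integrable_diff:
  assumes "square_integrable Y" "square_integrable Y'"
  shows "square_integrable (\<lambda>\<omega>. Y \<omega> - Y' \<omega>)"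
  using square_integrable_add[OF assms(1) square_integrable_scaleR[OF assms(2), of "-1"]] by simp

lemma square_integrable_const: "square_integrable (\<lambda>_. c)"
  by (simp add: square_integrable_def)

lemma square_integrable_sum:
  assumes "\<And>k. k \<in> K \<Longrightarrow> square_integrable (Y k)"
  shows "square_integrable (\<lambda>\<omega>. \<Sum>k\<in>K. Y k \<omega>)"
  using assms
  by (induction K rule: infinite_finite_induct) (auto intro: square_integrable_const square_integrable_add)

lemma square_integrable_cong:
  assumes "\<And>\<omega>. \<omega> \<in> space M \<Longrightarrow> Y \<omega> = Y' \<omega>" "square_integrable Y'"
  shows "square_integrable Y"
proof -
  have "Y \<in> borel_measurable M \<longleftrightarrow> Y' \<in> borel_measurable M"
    using assms(1) by (rule measurable_cong)
  moreover have "integrable M (\<lambda>\<omega>. (norm (Y \<omega>))\<^sup>2) \<longleftrightarrow> integrable M (\<lambda>\<omega>. (norm (Y' \<omega>))\<^sup>2)"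
    using assms(1) by (intro Bochner_Integration.integrable_cong) auto
  ultimately show ?thesis
    using assms(2) by (simp add: square_integrable_def)
qed

lemma square_integrable_bound:
  assumes "square_integrable Y'" "Y \<in> borel_measurable M" "\<And>\<omega>. norm (Y \<omega>) \<le> norm (Y' \<omega>)"
  shows "square_integrable Y"
  unfolding square_integrable_def
proof
  show "integrable M (\<lambda>\<omega>. (norm (Y \<omega>))\<^sup>2)"
  proof (rule Bochner_Integration.integrable_bound)
    show "integrable M (\<lambda>\<omega>. (norm (Y' \<omega>))\<^sup>2)"
      using assms(1) by (simp add: square_integrable_def)
  qed (use assms in \<open>auto intro: power_mono\<close>)
qed fact

lemma square_integrable_lipschitz:
  fixes F :: "'a \<Rightarrow> 'a"
  assumes Y: "square_integrable Y" and F: "F \<in> borel_measurable borel"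
    and lip: "\<And>x y. norm (F x - F y) \<le> L * norm (x - y)"
  shows "square_integrable (\<lambda>\<omega>. F (Y \<omega>))"
proof -
  have [measurable]: "Y \<in> borel_measurable M" "F \<in> borel_measurable borel"
    using Y F by (simp_all add: square_integrable_def)
  have "square_integrable (\<lambda>\<omega>. F (Y \<omega>) - F 0)"
  proof (rule square_integrable_bound[OF square_integrable_scaleR[OF Y, of L]])
    show "norm (F (Y \<omega>) - F 0) \<le> norm (L *\<^sub>R Y \<omega>)" for \<omega>
      using lip[of "Y \<omega>" 0] abs_ge_self[of L] mult_right_mono[of L "\<bar>L\<bar>" "norm (Y \<omega>)"] by simp
  qed measurable
  from square_integrable_add[OF this square_integrable_const[of "F 0"]] show ?thesis
    by simp
qed

end

locale stochastic_oracle = iid_samples M X I \<gamma>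
  for M :: "'w measure" and X :: "'i \<Rightarrow> 'w \<Rightarrow> 'a::euclidean_space" and I \<gamma> +
  fixes F :: "'a \<Rightarrow> 'a" and G :: "'a \<Rightarrow> 'a \<Rightarrow> 'a" and L V :: real
  assumes F_lip: "\<And>x y. norm (F x - F y) \<le> L * norm (x - y)"
    and G_meas: "(\<lambda>(y, u). G y u) \<in> borel_measurable (borel \<Otimes>\<^sub>M borel)"
    and G_int: "\<And>y. integrable \<gamma> (G y)" and G_mean: "\<And>y. (\<integral>u. G y u \<partial>\<gamma>) = F y"
    and G_sq: "\<And>y. integrable \<gamma> (\<lambda>u. (norm (G y u - F y))\<^sup>2)"
    and G_var: "\<And>y. (\<integral>u. (norm (G y u - F y))\<^sup>2 \<partial>\<gamma>) \<le> V"
begin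

lemma F_meas [measurable]: "F \<in> borel_measurable borel"
proof -
  have "F = (\<lambda>y. \<integral>u. G y u \<partial>\<gamma>)"
    by (simp add: G_mean)
  also have "\<dots> \<in> borel_measurable borel"
    using G_meas by (intro \<gamma>.borel_measurable_lebesgue_integral) (simp cong: measurable_cong_sets)
  finally show ?thesis .
qed

context
  fixes J and Y :: "'w \<Rightarrow> 'a"
  assumes Y: "determined J Y" "J \<subseteq> I"
begin

lemma noise_square_integrable:
  assumes "i \<in> I" "i \<notin> J"
  shows "square_integrable (\<lambda>\<omega>. G (Y \<omega>) (X i \<omega>) - F (Y \<omega>))"
    and "(\<integral>\<omega>. (norm (G (Y \<omega>) (X i \<omega>) - F (Y \<omega>)))\<^sup>2 \<partial>M) \<le> V"
proof -
  note [measurable] = G_meas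
  have meas: "(\<lambda>(y, u). (norm (G y u - F y))\<^sup>2) \<in> borel_measurable (borel \<Otimes>\<^sub>M borel)"
    by measurable
  have "integrable M (\<lambda>\<omega>. (norm (G (Y \<omega>) (X i \<omega>) - F (Y \<omega>)))\<^sup>2)"
    by (rule fresh_nonneg_integral_le(1)[OF Y assms meas _ G_sq G_var]) simp
  moreover have "(\<lambda>\<omega>. G (Y \<omega>) (X i \<omega>) - F (Y \<omega>)) \<in> borel_measurable M"
    by (rule fresh_measurable[OF Y assms, where H = "\<lambda>y u. G y u - F y"]) measurable
  ultimately show "square_integrable (\<lambda>\<omega>. G (Y \<omega>) (X i \<omega>) - F (Y \<omega>))"
    by (simp add: square_integrable_def)
  show "(\<integral>\<omega>. (norm (G (Y \<omega>) (X i \<omega>) - F (Y \<omega>)))\<^sup>2 \<partial>M) \<le> V"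
    by (rule fresh_nonneg_integral_le(2)[OF Y assms meas _ G_sq G_var]) simp
qed

text \<open>\<open>W\<close> may depend on more samples than the query point \<open>Y\<close>. This
  freedom covers the case where \<open>W\<close> is the noise of another sample at the same query
  point.\<close>

lemma noise_orthogonal:
  assumes W: "determined J' W" "J \<subseteq> J'" "J' \<subseteq> I" "square_integrable W" and i: "i \<in> I" "i \<notin> J'"
  shows "(\<integral>\<omega>. W \<omega> \<bullet> (G (Y \<omega>) (X i \<omega>) - F (Y \<omega>)) \<partial>M) = 0"
proof -
  note [measurable] = G_meas
  have YW: "determined J' (\<lambda>\<omega>. (Y \<omega>, W \<omega>))"
    by (rule determined_compose2[OF determined_mono[OF Y(1) W(2)] W(1)]) (simp add: borel_prod)
  define H where "H p u = snd p \<bullet> (G (fst p) u - F (fst p))" for p :: "'a \<times> 'a" and u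
  have "(\<integral>\<omega>. H (Y \<omega>, W \<omega>) (X i \<omega>) \<partial>M) = 0"
  proof (rule fresh_integral_zero[OF YW W(3) i])
    show "(\<lambda>(p, u). H p u) \<in> borel_measurable (borel \<Otimes>\<^sub>M borel)"
      unfolding H_def borel_prod[symmetric] by measurable
    show "integrable M (\<lambda>\<omega>. H (Y \<omega>, W \<omega>) (X i \<omega>))"
      using square_integrable_inner[OF W(4) noise_square_integrable(1)] i W(2) by (auto simp: H_def)
    show "(\<integral>u. H p u \<partial>\<gamma>) = 0" for p
      using G_int \<gamma>.prob_space by (simp add: H_def G_mean)
  qed
  then show ?thesis
    by (simp add: H_def)
qed

text \<open>The noises of one batch share \<open>Y\<close> and are dependent, but they are pairwise
  orthogonal. In the squared norm of the mean only \<open>n\<close> diagonal terms survive, which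
  gives \<open>V / n\<close>.\<close>

lemma batch_noise:
  fixes \<iota> :: "nat \<Rightarrow> 'i" and n :: nat
  assumes n: "1 \<le> n" and inj: "inj_on \<iota> {1..n}" and range: "\<iota> ` {1..n} \<subseteq> I - J"
  defines "e \<equiv> \<lambda>\<omega>. (1 / real n) *\<^sub>R (\<Sum>i=1..n. G (Y \<omega>) (X (\<iota> i) \<omega>)) - F (Y \<omega>)"
  shows "square_integrable e" and "(\<integral>\<omega>. (norm (e \<omega>))\<^sup>2 \<partial>M) \<le> V / n"
    and "determined (J \<union> \<iota> ` {1..n}) e"
    and "\<And>W. determined J W \<Longrightarrow> square_integrable W \<Longrightarrow> (\<integral>\<omega>. W \<omega> \<bullet> e \<omega> \<partial>M) = 0"
proof -
  define \<xi> where "\<xi> i \<omega> = G (Y \<omega>) (X (\<iota> i) \<omega>) - F (Y \<omega>)" for i \<omega>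
  have e_eq: "e \<omega> = (1 / real n) *\<^sub>R (\<Sum>i=1..n. \<xi> i \<omega>)" for \<omega>
    using n by (simp add: e_def \<xi>_def sum_subtractf scaleR_diff_right sum_constant_scaleR)
  have \<iota>: "\<iota> i \<in> I" "\<iota> i \<notin> J" if "i \<in> {1..n}" for i
    using range that by blast+
  have \<xi>_sq: "square_integrable (\<xi> i)" and \<xi>_var: "(\<integral>\<omega>. (norm (\<xi> i \<omega>))\<^sup>2 \<partial>M) \<le> V" if "i \<in> {1..n}" for i
    using noise_square_integrable[OF \<iota>[OF that]] by (simp_all add: \<xi>_def[abs_def])
  have \<xi>_det: "determined (J \<union> {\<iota> i}) (\<xi> i)" for i
    unfolding \<xi>_def[abs_def]
    by (intro determined_diff determined_compose2[OF _ _ G_meas] determined_compose[OF _ F_meas]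
        determined_mono[OF Y(1)] determined_sample) auto
  have e_fun: "e = (\<lambda>\<omega>. (1 / real n) *\<^sub>R (\<Sum>i=1..n. \<xi> i \<omega>))"
    using e_eq by blast
  show "square_integrable e"
    unfolding e_fun by (intro square_integrable_scaleR square_integrable_sum \<xi>_sq)
  show "determined (J \<union> \<iota> ` {1..n}) e"
    unfolding e_fun by (intro determined_scaleR determined_sum determined_mono[OF \<xi>_det]) auto
  show "(\<integral>\<omega>. W \<omega> \<bullet> e \<omega> \<partial>M) = 0" if W: "determined J W" "square_integrable W" for W
  proof -
    have "(\<integral>\<omega>. W \<omega> \<bullet> e \<omega> \<partial>M) = (\<integral>\<omega>. (1 / real n) * (\<Sum>i=1..n. W \<omega> \<bullet> \<xi> i \<omega>) \<partial>M)"
      by (simp add: e_eq inner_sum_right)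
    also have "\<dots> = (1 / real n) * (\<Sum>i=1..n. \<integral>\<omega>. W \<omega> \<bullet> \<xi> i \<omega> \<partial>M)"
      using W \<xi>_sq by (subst integral_mult_right_zero, subst Bochner_Integration.integral_sum)
        (auto intro: square_integrable_inner)
    also have "(\<Sum>i=1..n. \<integral>\<omega>. W \<omega> \<bullet> \<xi> i \<omega> \<partial>M) = 0"
      using noise_orthogonal[OF W(1) order_refl Y(2) W(2)] \<iota> by (intro sum.neutral) (simp add: \<xi>_def)
    finally show ?thesis by simp
  qed
  \<comment> \<open>Here the noise of sample \<open>i\<close> plays the part of the known vector,
    determined by \<open>J\<close> enlarged by that one index.\<close>
  have orth: "(\<integral>\<omega>. \<xi> i \<omega> \<bullet> \<xi> j \<omega> \<partial>M) = 0" if "i \<in> {1..n}" "j \<in> {1..n}" "i \<noteq> j" for i j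
  proof -
    have "\<iota> j \<noteq> \<iota> i"
      using that inj by (auto dest: inj_onD)
    then have "(\<integral>\<omega>. \<xi> i \<omega> \<bullet> (G (Y \<omega>) (X (\<iota> j) \<omega>) - F (Y \<omega>)) \<partial>M) = 0"
      using Y(2) \<iota>[OF that(1)] \<iota>[OF that(2)]
      by (intro noise_orthogonal[OF \<xi>_det[of i]] \<xi>_sq that) auto
    then show ?thesis
      by (simp add: \<xi>_def)
  qed
  have "(norm (e \<omega>))\<^sup>2 = (1 / (real n)\<^sup>2) * (\<Sum>i=1..n. \<Sum>j=1..n. \<xi> i \<omega> \<bullet> \<xi> j \<omega>)" for \<omega>
  proof -
    have "(\<Sum>i=1..n. \<xi> i \<omega>) \<bullet> (\<Sum>j=1..n. \<xi> j \<omega>) = (\<Sum>i=1..n. \<Sum>j=1..n. \<xi> i \<omega> \<bullet> \<xi> j \<omega>)"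
      by (simp only: inner_sum_left) (simp only: inner_sum_right)
    then show ?thesis
      unfolding e_eq by (simp add: power_mult_distrib power_divide flip: power2_norm_eq_inner)
  qed
  then have "(\<integral>\<omega>. (norm (e \<omega>))\<^sup>2 \<partial>M) =
      (1 / (real n)\<^sup>2) * (\<integral>\<omega>. (\<Sum>i=1..n. \<Sum>j=1..n. \<xi> i \<omega> \<bullet> \<xi> j \<omega>) \<partial>M)"
    by (simp only: integral_mult_right_zero)
  also have "(\<integral>\<omega>. (\<Sum>i=1..n. \<Sum>j=1..n. \<xi> i \<omega> \<bullet> \<xi> j \<omega>) \<partial>M) =
      (\<Sum>i=1..n. \<integral>\<omega>. (\<Sum>j=1..n. \<xi> i \<omega> \<bullet> \<xi> j \<omega>) \<partial>M)"
    by (intro Bochner_Integration.integral_sum Bochner_Integration.integrable_sum square_integrable_inner \<xi>_sq)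
  also have "\<dots> = (\<Sum>i=1..n. \<Sum>j=1..n. \<integral>\<omega>. \<xi> i \<omega> \<bullet> \<xi> j \<omega> \<partial>M)"
    by (intro sum.cong refl Bochner_Integration.integral_sum square_integrable_inner \<xi>_sq)
  also have "(\<Sum>i=1..n. \<Sum>j=1..n. \<integral>\<omega>. \<xi> i \<omega> \<bullet> \<xi> j \<omega> \<partial>M) = (\<Sum>i=1..n. \<integral>\<omega>. \<xi> i \<omega> \<bullet> \<xi> i \<omega> \<partial>M)"
  proof (rule sum.cong[OF refl])
    fix i assume i: "i \<in> {1..n}"
    show "(\<Sum>j=1..n. \<integral>\<omega>. \<xi> i \<omega> \<bullet> \<xi> j \<omega> \<partial>M) = (\<integral>\<omega>. \<xi> i \<omega> \<bullet> \<xi> i \<omega> \<partial>M)"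
      using i orth by (subst sum.remove[of _ i]) (auto intro!: sum.neutral)
  qed
  also have "(1 / (real n)\<^sup>2) * (\<Sum>i=1..n. \<integral>\<omega>. \<xi> i \<omega> \<bullet> \<xi> i \<omega> \<partial>M) \<le> (1 / (real n)\<^sup>2) * (\<Sum>i=1..n. V)"
    using \<xi>_var by (intro mult_left_mono sum_mono) (simp_all add: power2_norm_eq_inner)
  finally show "(\<integral>\<omega>. (norm (e \<omega>))\<^sup>2 \<partial>M) \<le> V / n"
    using n by (simp add: power2_eq_square)
qed

end

end

section \<open>Stochastic extragradient steps\<close>

text \<open>The coefficient 3 of \<open>norm e\<close> allows \<open>L * h1 = 1\<close>: polarisation bounds
  \<open>2 * (p \<bullet> F z)\<close> for \<open>p = F (z - h1 (F z + e))\<close> from below, and \<open>p\<close> depends on \<open>e\<close> in a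
  Lipschitz way, so that only \<open>F (z - h1 F z)\<close>, which is independent of \<open>e\<close>, pairs with \<open>e\<close> to
  first order.\<close>

lemma extragradient_descent:
  fixes F :: "'a::real_inner \<Rightarrow> 'a"
  assumes lip: "\<And>x y. norm (F x - F y) \<le> L * norm (x - y)"
    and h1: "0 < h1" "L * h1 \<le> 1" and h2: "0 < h2"
    and minty: "0 \<le> F y \<bullet> (y - s) + r * (norm (F y))\<^sup>2 + \<epsilon>"
    and y: "y = z - h1 *\<^sub>R (F z + e)" and z': "z' = z - h2 *\<^sub>R (F y + e')"
  shows "(norm (z' - s))\<^sup>2 \<le> (norm (z - s))\<^sup>2 - (h1 * h2 - h2\<^sup>2 - 2 * h2 * r) * (norm (F y))\<^sup>2
    + 2 * h2 * \<epsilon> - 2 * h1 * h2 * ((F (z - h1 *\<^sub>R F z) - F z) \<bullet> e) + 3 * h1 * h2 * (norm e)\<^sup>2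
    + h2\<^sup>2 * (norm e')\<^sup>2 + ((2 * h2\<^sup>2) *\<^sub>R F y - (2 * h2) *\<^sub>R (z - s)) \<bullet> e'"
proof -
  define p where "p = F y"
  define q where "q = F (z - h1 *\<^sub>R F z)"
  define x where "x = F z"
  define w where "w = z - s"
  have nonexp: "L * (h1 * c) \<le> c" if "0 \<le> c" for c
    using mult_right_mono[OF h1(2) that] by (simp add: mult.assoc)
  have "norm (p - x) \<le> L * norm (y - z)"
    unfolding p_def x_def by (rule lip)
  also have "\<dots> = L * (h1 * norm (x + e))"
    using h1(1) by (simp add: y x_def)
  also have "\<dots> \<le> norm (x + e)"
    by (rule nonexp) simp
  finally have "(norm (p - x))\<^sup>2 \<le> (norm (x + e))\<^sup>2"
    by (rule power_mono) simp
  \<comment> \<open>\<open>x \<bullet> x\<close> cancels between the two squares. This cancellation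
    is what admits \<open>L * h1 = 1\<close>.\<close>
  then have A1: "2 * (p \<bullet> x) \<ge> p \<bullet> p - 2 * (x \<bullet> e) - e \<bullet> e"
    by (simp add: power2_norm_eq_inner inner_diff_left inner_diff_right inner_add_left inner_add_right
        inner_commute[of x p] inner_commute[of e x])
  have "norm (q - p) \<le> L * norm ((z - h1 *\<^sub>R x) - y)"
    unfolding p_def q_def x_def by (rule lip)
  also have "\<dots> = L * (h1 * norm e)"
    using h1(1) by (simp add: y x_def algebra_simps)
  also have "\<dots> \<le> norm e"
    by (rule nonexp) simp
  finally have "(q - p) \<bullet> e \<le> norm e * norm e"
    using norm_cauchy_schwarz[of "q - p" e] mult_right_mono[of "norm (q - p)" "norm e" "norm e"] by simp
  \<comment> \<open>\<open>q\<close> is the operator at the half step without noise; exchanging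
    \<open>p\<close> for it costs \<open>2 * (e \<bullet> e)\<close>, which with the
    \<open>e \<bullet> e\<close> of \<open>A1\<close> makes 3.\<close>
  then have A2: "2 * (p \<bullet> e) \<ge> 2 * (q \<bullet> e) - 2 * (e \<bullet> e)"
    by (simp add: inner_diff_left power2_norm_eq_inner[symmetric] power2_eq_square)
  have ys: "y - s = w - h1 *\<^sub>R (x + e)"
    by (simp add: y w_def x_def)
  have "p \<bullet> (y - s) = p \<bullet> w - h1 * (p \<bullet> x) - h1 * (p \<bullet> e)"
    unfolding ys by (simp add: inner_diff_right inner_add_right algebra_simps)
  then have "0 \<le> p \<bullet> w - h1 * (p \<bullet> x) - h1 * (p \<bullet> e) + r * (p \<bullet> p) + \<epsilon>"
    using minty by (simp add: p_def[symmetric] power2_norm_eq_inner)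
  then have A3: "0 \<le> (2 * h2) * (p \<bullet> w - h1 * (p \<bullet> x) - h1 * (p \<bullet> e) + r * (p \<bullet> p) + \<epsilon>)"
    using h2 by simp
  \<comment> \<open>When \<open>A3\<close> and \<open>A4\<close> are added to the expansion of the
    squared distance, the products of \<open>p\<close> with \<open>w\<close>, \<open>x\<close> and
    \<open>e\<close> all cancel.\<close>
  have A4: "0 \<le> (h1 * h2) * (2 * (p \<bullet> x) + 2 * (p \<bullet> e) - p \<bullet> p + 2 * (x \<bullet> e) - 2 * (q \<bullet> e) + 3 * (e \<bullet> e))"
    using A1 A2 h1(1) h2 by (intro mult_nonneg_nonneg) auto
  have z's: "z' - s = w - h2 *\<^sub>R (p + e')"
    by (simp add: z' w_def p_def)
  have "(norm (z' - s))\<^sup>2 = w \<bullet> w - 2 * h2 * (p \<bullet> w) - 2 * h2 * (w \<bullet> e')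
      + h2\<^sup>2 * (p \<bullet> p) + 2 * h2\<^sup>2 * (p \<bullet> e') + h2\<^sup>2 * (e' \<bullet> e')"
    unfolding z's power2_norm_eq_inner
    by (simp add: inner_diff_left inner_diff_right inner_add_left inner_add_right
        inner_commute[of w p] inner_commute[of e' w] inner_commute[of e' p] power2_eq_square algebra_simps)
  moreover have "F (z - h1 *\<^sub>R x) = q"
    by (simp add: q_def x_def)
  ultimately show ?thesis
    using A3 A4 unfolding p_def[symmetric] x_def[symmetric] w_def[symmetric]
    by (simp add: power2_norm_eq_inner inner_diff_left algebra_simps)
qed

locale stochastic_extragradient = stochastic_oracle M X I \<gamma> F G L V
  for M :: "'w measure" and X :: "bool \<times> nat \<times> nat \<Rightarrow> 'w \<Rightarrow> 'a::euclidean_space" and I \<gamma> F G L V +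
  fixes t :: "nat \<Rightarrow> nat" and z zh :: "nat \<Rightarrow> 'w \<Rightarrow> 'a" and h1 h2 r \<epsilon> :: real and z0 s :: 'a
  assumes I_eq: "I = {(b, k, i). i \<in> {1..t k}}" and t_pos: "\<And>k. 1 \<le> t k"
    and h1_pos: "0 < h1" and L_h1: "L * h1 \<le> 1" and h2_pos: "0 < h2"
    and minty: "\<And>w. 0 \<le> F w \<bullet> (w - s) + r * (norm (F w))\<^sup>2 + \<epsilon>"
    and z_0: "\<And>\<omega>. \<omega> \<in> space M \<Longrightarrow> z 0 \<omega> = z0"
    and zh_step: "\<And>k \<omega>. \<omega> \<in> space M \<Longrightarrow> zh k \<omega> = z k \<omega> -
      h1 *\<^sub>R ((1 / real (t k)) *\<^sub>R (\<Sum>i=1..t k. G (z k \<omega>) (X (True, k, i) \<omega>)))"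
    and z_step: "\<And>k \<omega>. \<omega> \<in> space M \<Longrightarrow> z (Suc k) \<omega> = z k \<omega> -
      h2 *\<^sub>R ((1 / real (t k)) *\<^sub>R (\<Sum>i=1..t k. G (zh k \<omega>) (X (False, k, i) \<omega>)))"
begin

text \<open>In an index \<open>(b, k, i)\<close> the flag \<open>b\<close> marks the samples of the half step; \<open>z k\<close> depends on the
  samples in \<open>J k\<close>, and \<open>zh k\<close> on those in \<open>Jh k\<close>.\<close>

definition J where "J k = {(b, j, i). i \<in> {1..t j} \<and> j < k}"
definition Jh where "Jh k = J k \<union> (\<lambda>i. (True, k, i)) ` {1..t k}"

definition e where
  "e k \<omega> = (1 / real (t k)) *\<^sub>R (\<Sum>i=1..t k. G (z k \<omega>) (X (True, k, i) \<omega>)) - F (z k \<omega>)"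
definition eh where
  "eh k \<omega> = (1 / real (t k)) *\<^sub>R (\<Sum>i=1..t k. G (zh k \<omega>) (X (False, k, i) \<omega>)) - F (zh k \<omega>)"

lemma J_subset: "J k \<subseteq> I" and Jh_subset: "Jh k \<subseteq> I"
  by (auto simp: J_def Jh_def I_eq)

lemma J_Suc: "J (Suc k) = Jh k \<union> (\<lambda>i. (False, k, i)) ` {1..t k}"
  by (auto simp: J_def Jh_def less_Suc_eq image_iff)

lemma fresh_first: "(\<lambda>i. (True, k, i)) ` {1..t k} \<subseteq> I - J k"
  by (auto simp: J_def I_eq)

lemma fresh_second: "(\<lambda>i. (False, k, i)) ` {1..t k} \<subseteq> I - Jh k"
  by (auto simp: J_def Jh_def I_eq)

lemma zh_eq: "\<omega> \<in> space M \<Longrightarrow> zh k \<omega> = z k \<omega> - h1 *\<^sub>R (F (z k \<omega>) + e k \<omega>)"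
  by (simp add: zh_step e_def)

lemma z_Suc_eq: "\<omega> \<in> space M \<Longrightarrow> z (Suc k) \<omega> = z k \<omega> - h2 *\<^sub>R (F (zh k \<omega>) + eh k \<omega>)"
  by (simp add: z_step eh_def)

lemma first_noise:
  assumes "determined (J k) (z k)"
  shows "square_integrable (e k)" "(\<integral>\<omega>. (norm (e k \<omega>))\<^sup>2 \<partial>M) \<le> V / t k" "determined (Jh k) (e k)"
    and "\<And>W. determined (J k) W \<Longrightarrow> square_integrable W \<Longrightarrow> (\<integral>\<omega>. W \<omega> \<bullet> e k \<omega> \<partial>M) = 0"
  using batch_noise[OF assms J_subset t_pos _ fresh_first] unfolding e_def[abs_def] Jh_def
  by (auto simp: inj_on_def)

lemma second_noise:
  assumes "determined (Jh k) (zh k)"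
  shows "square_integrable (eh k)" "(\<integral>\<omega>. (norm (eh k \<omega>))\<^sup>2 \<partial>M) \<le> V / t k" "determined (J (Suc k)) (eh k)"
    and "\<And>W. determined (Jh k) W \<Longrightarrow> square_integrable W \<Longrightarrow> (\<integral>\<omega>. W \<omega> \<bullet> eh k \<omega> \<partial>M) = 0"
  using batch_noise[OF assms Jh_subset t_pos _ fresh_second] unfolding eh_def[abs_def] J_Suc
  by (auto simp: inj_on_def)

lemma determined_zh:
  assumes "determined (J k) (z k)"
  shows "determined (Jh k) (zh k)"
proof (rule determined_cong[OF zh_eq])
  have "determined (Jh k) (z k)"
    by (rule determined_mono[OF assms]) (auto simp: Jh_def)
  then show "determined (Jh k) (\<lambda>\<omega>. z k \<omega> - h1 *\<^sub>R (F (z k \<omega>) + e k \<omega>))"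
    by (intro determined_diff determined_scaleR determined_add determined_compose[OF _ F_meas]
        first_noise(3) assms)
qed

lemma square_integrable_zh:
  assumes "determined (J k) (z k)" "square_integrable (z k)"
  shows "square_integrable (zh k)"
proof (rule square_integrable_cong[OF zh_eq])
  show "square_integrable (\<lambda>\<omega>. z k \<omega> - h1 *\<^sub>R (F (z k \<omega>) + e k \<omega>))"
    by (intro square_integrable_diff square_integrable_scaleR square_integrable_add
        square_integrable_lipschitz[OF _ F_meas F_lip] first_noise(1) assms)
qed

text \<open>The noise is known to be square integrable only because its query point is determined by
  earlier samples, so both properties are carried through one induction.\<close>

lemma z_regular: "determined (J k) (z k) \<and> square_integrable (z k)"
proof (induction k)
  case 0
  show ?case
    using determined_cong[of "z 0" "\<lambda>_. z0", OF z_0 determined_const]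
      square_integrable_cong[of "z 0" "\<lambda>_. z0", OF z_0 square_integrable_const]
    by blast
next
  case (Suc k)
  then have z: "determined (J k) (z k)" "square_integrable (z k)"
    by auto
  note zh = determined_zh[OF z(1)] square_integrable_zh[OF z]
  have sub: "J k \<subseteq> J (Suc k)" "Jh k \<subseteq> J (Suc k)"
    by (auto simp: J_def Jh_def)
  have "determined (J (Suc k)) (\<lambda>\<omega>. z k \<omega> - h2 *\<^sub>R (F (zh k \<omega>) + eh k \<omega>))"
    by (intro determined_diff determined_scaleR determined_add determined_compose[OF _ F_meas]
        second_noise(3) determined_mono[OF z(1) sub(1)] determined_mono[OF zh(1) sub(2)] zh(1))
  moreover have "square_integrable (\<lambda>\<omega>. z k \<omega> - h2 *\<^sub>R (F (zh k \<omega>) + eh k \<omega>))"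
    by (intro square_integrable_diff square_integrable_scaleR square_integrable_add
        square_integrable_lipschitz[OF _ F_meas F_lip] second_noise(1) zh z)
  ultimately show ?case
    using determined_cong[of "z (Suc k)", OF z_Suc_eq] square_integrable_cong[of "z (Suc k)", OF z_Suc_eq]
    by blast
qed

lemma z_determined: "determined (J k) (z k)" and z_square_integrable: "square_integrable (z k)"
  using z_regular by auto

lemma F_zh_square_integrable: "square_integrable (\<lambda>\<omega>. F (zh k \<omega>))"
  by (intro square_integrable_lipschitz[OF _ F_meas F_lip] square_integrable_zh z_determined z_square_integrable)

lemma expected_descent:
  "(h1 * h2 - h2\<^sup>2 - 2 * h2 * r) * (\<integral>\<omega>. (norm (F (zh k \<omega>)))\<^sup>2 \<partial>M) \<le>
    (\<integral>\<omega>. (norm (z k \<omega> - s))\<^sup>2 \<partial>M) - (\<integral>\<omega>. (norm (z (Suc k) \<omega> - s))\<^sup>2 \<partial>M)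
    + 2 * h2 * \<epsilon> + (h2\<^sup>2 + 3 * h1 * h2) * (V / t k)"
proof -
  note z = z_determined[of k] z_square_integrable[of k]
  note zh = determined_zh[OF z(1)] square_integrable_zh[OF z]
  note noise1 = first_noise[OF z(1)] and noise2 = second_noise[OF zh(1)]
  \<comment> \<open>\<open>W\<close> and \<open>W'\<close> collect everything that pairs linearly
    with the two errors. \<open>W\<close> depends on the samples before iteration \<open>k\<close>,
    \<open>W'\<close> also on those of its half step; each is therefore orthogonal to its
    error.\<close>
  define W where "W \<omega> = F (z k \<omega> - h1 *\<^sub>R F (z k \<omega>)) - F (z k \<omega>)" for \<omega>
  define W' where "W' \<omega> = (2 * h2\<^sup>2) *\<^sub>R F (zh k \<omega>) - (2 * h2) *\<^sub>R (z k \<omega> - s)" for \<omega>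
  have W: "determined (J k) W" "square_integrable W"
    unfolding W_def[abs_def]
    by (intro determined_diff determined_scaleR determined_compose[OF _ F_meas] z
        square_integrable_diff square_integrable_scaleR square_integrable_lipschitz[OF _ F_meas F_lip])+
  have W': "determined (Jh k) W'" "square_integrable W'"
    unfolding W'_def[abs_def]
    by (intro determined_diff determined_scaleR determined_compose[OF _ F_meas] determined_const
        determined_mono[OF z(1)] z zh square_integrable_const
        square_integrable_diff square_integrable_scaleR square_integrable_lipschitz[OF _ F_meas F_lip];
        auto simp: Jh_def)+
  define D where "D k = (\<integral>\<omega>. (norm (z k \<omega> - s))\<^sup>2 \<partial>M)" for k
  define c where "c = h1 * h2 - h2\<^sup>2 - 2 * h2 * r"
  have int_D: "integrable M (\<lambda>\<omega>. (norm (z j \<omega> - s))\<^sup>2)" for j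
    using square_integrable_diff[OF z_square_integrable square_integrable_const]
    unfolding square_integrable_def by blast
  have int: "integrable M (\<lambda>\<omega>. (norm (F (zh k \<omega>)))\<^sup>2)" "integrable M (\<lambda>\<omega>. (norm (e k \<omega>))\<^sup>2)"
    "integrable M (\<lambda>\<omega>. (norm (eh k \<omega>))\<^sup>2)"
    using F_zh_square_integrable noise1(1) noise2(1) by (auto simp: square_integrable_def)
  have int': "integrable M (\<lambda>\<omega>. W \<omega> \<bullet> e k \<omega>)" "integrable M (\<lambda>\<omega>. W' \<omega> \<bullet> eh k \<omega>)"
    using W(2) W'(2) noise1(1) noise2(1) by (auto intro: square_integrable_inner)
  have "D (Suc k) \<le> (\<integral>\<omega>. (norm (z k \<omega> - s))\<^sup>2 - c * (norm (F (zh k \<omega>)))\<^sup>2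
      + 2 * h2 * \<epsilon> - 2 * h1 * h2 * (W \<omega> \<bullet> e k \<omega>) + 3 * h1 * h2 * (norm (e k \<omega>))\<^sup>2
      + h2\<^sup>2 * (norm (eh k \<omega>))\<^sup>2 + W' \<omega> \<bullet> eh k \<omega> \<partial>M)"
    unfolding D_def
  proof (rule integral_mono)
    fix \<omega> assume \<omega>: "\<omega> \<in> space M"
    show "(norm (z (Suc k) \<omega> - s))\<^sup>2 \<le> (norm (z k \<omega> - s))\<^sup>2 - c * (norm (F (zh k \<omega>)))\<^sup>2
      + 2 * h2 * \<epsilon> - 2 * h1 * h2 * (W \<omega> \<bullet> e k \<omega>) + 3 * h1 * h2 * (norm (e k \<omega>))\<^sup>2
      + h2\<^sup>2 * (norm (eh k \<omega>))\<^sup>2 + W' \<omega> \<bullet> eh k \<omega>"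
      unfolding c_def W_def W'_def
      by (rule extragradient_descent[OF F_lip h1_pos L_h1 h2_pos minty zh_eq[OF \<omega>] z_Suc_eq[OF \<omega>]])
  qed (use int int' int_D in auto)
  also have "\<dots> = D k - c * (\<integral>\<omega>. (norm (F (zh k \<omega>)))\<^sup>2 \<partial>M) + 2 * h2 * \<epsilon>
      + 3 * h1 * h2 * (\<integral>\<omega>. (norm (e k \<omega>))\<^sup>2 \<partial>M) + h2\<^sup>2 * (\<integral>\<omega>. (norm (eh k \<omega>))\<^sup>2 \<partial>M)"
    using int int' int_D noise1(4)[OF W] noise2(4)[OF W'] prob_space by (simp add: D_def)
  also have "\<dots> \<le> D k - c * (\<integral>\<omega>. (norm (F (zh k \<omega>)))\<^sup>2 \<partial>M) + 2 * h2 * \<epsilon>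
      + 3 * h1 * h2 * (V / t k) + h2\<^sup>2 * (V / t k)"
    using h1_pos h2_pos by (intro add_mono mult_left_mono order_refl noise1(2) noise2(2)) auto
  finally show ?thesis
    by (simp add: c_def D_def algebra_simps)
qed

lemma sum_expected_le:
  "(h1 * h2 - h2\<^sup>2 - 2 * h2 * r) * (\<Sum>k=0..N. \<integral>\<omega>. (norm (F (zh k \<omega>)))\<^sup>2 \<partial>M) \<le>
    (norm (z0 - s))\<^sup>2 + (real N + 1) * (2 * h2 * \<epsilon>)
    + (h2\<^sup>2 + 3 * h1 * h2) * V * (\<Sum>k=0..N. 1 / real (t k))"
proof -
  define D where "D k = (\<integral>\<omega>. (norm (z k \<omega> - s))\<^sup>2 \<partial>M)" for k
  have "(h1 * h2 - h2\<^sup>2 - 2 * h2 * r) * (\<Sum>k=0..N. \<integral>\<omega>. (norm (F (zh k \<omega>)))\<^sup>2 \<partial>M) \<le>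
      (\<Sum>k=0..N. (D k - D (Suc k)) + 2 * h2 * \<epsilon> + (h2\<^sup>2 + 3 * h1 * h2) * V * (1 / real (t k)))"
    unfolding sum_distrib_left
    by (rule sum_mono) (use expected_descent in \<open>simp add: D_def\<close>)
  also have "\<dots> = (D 0 - D (Suc N)) + (real N + 1) * (2 * h2 * \<epsilon>)
      + (h2\<^sup>2 + 3 * h1 * h2) * V * (\<Sum>k=0..N. 1 / real (t k))"
    by (simp add: sum.distrib sum_distrib_left atLeast0AtMost sum_telescope)
  also have "D 0 = (norm (z0 - s))\<^sup>2"
    using z_0 prob_space by (simp add: D_def cong: Bochner_Integration.integral_cong)
  \<comment> \<open>The telescoped remainder \<open>D (Suc N)\<close> is nonnegative and is
    dropped.\<close>
  finally show ?thesis
    by (smt (verit, best) Bochner_Integration.integral_nonneg D_def zero_le_power2)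
qed

end

section \<open>The zeroth-order method\<close>

lemma spd_self_adjoint: "spd M \<Longrightarrow> x \<bullet> (M *v y) = (M *v x) \<bullet> y"
  by (metis spd_def dot_lmul_matrix transpose_matrix_vector)

lemma spd_invertible:
  assumes "spd M"
  shows "invertible M"
proof -
  have "x = 0" if "M *v x = 0" for x
    using assms that unfolding spd_def by (metis inner_zero_right less_irrefl)
  then show ?thesis
    by (simp add: invertible_left_inverse matrix_left_invertible_ker)
qed

lemma spd_matrix_inv:
  assumes "spd M"
  shows "M ** matrix_inv M = mat 1" "matrix_inv M ** M = mat 1"
  using someI_ex[OF spd_invertible[OF assms, unfolded invertible_def]]
  by (simp_all add: matrix_inv_def)

lemma bdiag_inverse:
  assumes "spd B1" "spd B2"
  shows "bdiag (matrix_inv B1) (matrix_inv B2) (bdiag B1 B2 x) = x"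
    and "bdiag B1 B2 (bdiag (matrix_inv B1) (matrix_inv B2) x) = x"
  using assms[THEN spd_matrix_inv(1)] assms[THEN spd_matrix_inv(2)]
  by (simp_all add: bdiag_def matrix_vector_mul_assoc)

lemma linear_bdiag: "linear (bdiag B1 B2)"
  by (intro linearI) (simp_all add: bdiag_def matrix_vector_right_distrib scaleR_matrix_vector_assoc
      matrix_vector_mult_scaleR)

lemma bdiag_self_adjoint:
  assumes "spd B1" "spd B2"
  shows "x \<bullet> bdiag B1 B2 y = bdiag B1 B2 x \<bullet> y"
  using assms by (simp add: bdiag_def inner_prod_def spd_self_adjoint)

lemma bdiag_pos:
  assumes "spd B1" "spd B2" "x \<noteq> 0"
  shows "0 < x \<bullet> bdiag B1 B2 x"
proof -
  have nonneg: "0 \<le> fst x \<bullet> (B1 *v fst x)" "0 \<le> snd x \<bullet> (B2 *v snd x)"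
    using assms(1,2) unfolding spd_def by (metis inner_zero_left less_eq_real_def)+
  have "fst x \<noteq> 0 \<or> snd x \<noteq> 0"
    using assms(3) by (simp add: prod_eq_iff)
  then have "0 < fst x \<bullet> (B1 *v fst x) \<or> 0 < snd x \<bullet> (B2 *v snd x)"
    using assms(1,2) by (auto simp: spd_def)
  with nonneg show ?thesis
    by (auto simp: bdiag_def inner_prod_def)
qed

text \<open>\<open>grad\<close> is a definite description, so a gradient must first be exhibited:
  the Riesz vector of the derivative, with its values on the basis as coordinates.\<close>

lemma differentiable_GDERIV_grad:
  fixes f :: "'a::euclidean_space \<Rightarrow> real"
  assumes "f differentiable (at w)"
  shows "GDERIV f w :> grad f w"
proof -
  obtain f' where f': "(f has_derivative f') (at w)"
    using assms unfolding differentiable_def by blast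
  then interpret linear f'
    by (rule has_derivative_linear)
  define v where "v = (\<Sum>b\<in>Basis. f' b *\<^sub>R b)"
  have "f' = (\<lambda>h. h \<bullet> v)"
  proof
    fix h
    have "f' h = f' (\<Sum>b\<in>Basis. (h \<bullet> b) *\<^sub>R b)"
      by (simp add: euclidean_representation)
    also have "\<dots> = h \<bullet> v"
      by (simp add: sum scale v_def inner_sum_right mult.commute)
    finally show "f' h = h \<bullet> v" .
  qed
  then have "GDERIV f w :> v"
    using f' by (simp add: gderiv_def)
  then show ?thesis
    by (simp add: grad_eq)
qed

text \<open>\<open>saddle_op\<close> is built from partial gradients; the chain rule along the two
  coordinate embeddings reads them off the full gradient.\<close>

lemma saddle_op_GDERIV:
  fixes f :: "(real^'n) \<times> (real^'m) \<Rightarrow> real"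
  assumes "GDERIV f w :> v"
  shows "saddle_op f w = (fst v, - snd v)"
proof -
  have f: "(f has_derivative (\<lambda>h. h \<bullet> v)) (at (fst w, snd w))"
    using assms by (simp add: gderiv_def)
  have "((\<lambda>x. (x, snd w)) has_derivative (\<lambda>h. (h, 0))) (at (fst w))"
    by (auto intro!: derivative_eq_intros)
  from has_derivative_compose[OF this f] have "GDERIV (\<lambda>x. f (x, snd w)) (fst w) :> fst v"
    by (simp add: gderiv_def inner_prod_def)
  moreover have "((\<lambda>y. (fst w, y)) has_derivative (\<lambda>h. (0, h))) (at (snd w))"
    by (auto intro!: derivative_eq_intros)
  from has_derivative_compose[OF this f] have "GDERIV (\<lambda>y. f (fst w, y)) (snd w) :> snd v"
    by (simp add: gderiv_def inner_prod_def)
  ultimately show ?thesis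
    by (simp add: saddle_op_def grad_eq)
qed

text \<open>Pure arithmetic: the summed descent, with \<open>S\<close>, \<open>D\<close> and
  \<open>T\<close> in place of the sums, is divided by its coefficient and relaxed to the stated
  constants.\<close>

lemma rate_from_descent:
  fixes lo hi \<kappa> L1 \<mu> \<sigma> \<rho> h1 h2 S D T d n :: real
  assumes lo: "0 < lo" and hi: "0 < hi" and \<kappa>: "\<kappa> = hi / lo" and L1: "0 < L1" and rho: "0 \<le> \<rho>"
    and h1: "h1 \<le> 1 / (L1 * hi * \<kappa>)"
    and h2: "0 < h2" "sqrt (2 * \<rho> / (L1 * hi * lo * \<kappa>)) < h2" "h2 \<le> h1 / 2"
    and nonneg: "0 \<le> S" "0 \<le> D" "0 \<le> T" "0 \<le> d" "0 < n"
    and descent: "(h1 * h2 - h2\<^sup>2 - 2 * h2 * (\<rho> / (2 * lo))) * S \<le>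
      D + n * (2 * h2 * (\<mu>\<^sup>2 * L1 * d + \<rho> / 2 * (L1\<^sup>2 * \<mu>\<^sup>2 * d))) + (h2\<^sup>2 + 3 * h1 * h2) * (hi * \<sigma>\<^sup>2) * T"
  shows "1 / n * S \<le> 2 * hi * lo * L1 * \<kappa> * D / ((hi * lo * L1 * \<kappa> * h2\<^sup>2 - 2 * \<rho>) * n)
      + 2 * lo * \<mu>\<^sup>2 * L1 * d / (hi * lo * L1 * \<kappa> * h2\<^sup>2 - 2 * \<rho>)
      + 2 * lo * \<mu>\<^sup>2 * L1\<^sup>2 * \<rho> * (d + 3) ^ 3 / (hi * lo * L1 * \<kappa> * h2\<^sup>2 - 2 * \<rho>)
      + 3 * lo * \<sigma>\<^sup>2 / (L1 * \<kappa> * (hi * lo * L1 * \<kappa> * h2\<^sup>2 - 2 * \<rho>)) * (1 / n * T)"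
proof -
  \<comment> \<open>\<open>1 / q\<close> is the largest admissible \<open>h1\<close>. With
    \<open>c\<close> as below, \<open>q * lo * c\<close> is the denominator of the claim, and the
    lower bound on \<open>h2\<close> says that \<open>c\<close> is positive.\<close>
  define q where "q = L1 * hi * \<kappa>"
  define c where "c = h2\<^sup>2 - 2 * \<rho> / (q * lo)"
  define \<epsilon> where "\<epsilon> = \<mu>\<^sup>2 * L1 * d + \<rho> / 2 * (L1\<^sup>2 * \<mu>\<^sup>2 * d)"
  have kpos: "0 < \<kappa>" and q: "0 < q"
    using lo hi L1 by (simp_all add: \<kappa> q_def)
  have eps: "0 \<le> \<epsilon>"
    using L1 rho nonneg by (simp add: \<epsilon>_def)
  have E_eq: "hi * lo * L1 * \<kappa> * h2\<^sup>2 - 2 * \<rho> = q * lo * c"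
    using lo hi L1 kpos by (simp add: q_def c_def field_simps)
  have "0 \<le> 2 * \<rho> / (L1 * hi * lo * \<kappa>)"
    using lo hi L1 kpos rho by simp
  then have "2 * \<rho> / (L1 * hi * lo * \<kappa>) < h2\<^sup>2"
    using power_strict_mono[OF h2(2), of 2] by simp
  then have c: "0 < c"
    by (simp add: c_def q_def mult_ac)
  have h1q: "h1 \<le> 1 / q"
    using h1 by (simp add: q_def)
  have "h2 \<le> (1 / q) / 2"
    using order_trans[OF h2(3) divide_right_mono[OF h1q, of 2]] by simp
  then have h2q: "h2 \<le> 1 / (2 * q)"
    by (simp add: mult.commute)
  have h1pos: "0 < h1"
    using h2 by simp
  \<comment> \<open>\<open>h2 \<le> h1 / 2\<close> gives
    \<open>h1 * h2 - h2\<^sup>2 \<ge> h2\<^sup>2\<close>; the loss \<open>h2 * (\<rho> / lo)\<close>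
    is bounded through \<open>h2 \<le> 1 / (2 * q)\<close>.\<close>
  have "c \<le> h1 * h2 - h2\<^sup>2 - 2 * h2 * (\<rho> / (2 * lo))"
  proof -
    have "2 * h2 * h2 \<le> h1 * h2"
      using h2 by (intro mult_right_mono) auto
    moreover have "h2 * (\<rho> / lo) \<le> 2 / q * (\<rho> / lo)"
    proof (rule mult_right_mono)
      have "1 / (2 * q) \<le> 2 / q"
        using q by (simp add: field_simps)
      with h2q show "h2 \<le> 2 / q" by linarith
    qed (use rho lo in simp)
    ultimately show ?thesis
      by (simp add: c_def power2_eq_square mult_ac)
  qed
  then have "c * S \<le> (h1 * h2 - h2\<^sup>2 - 2 * h2 * (\<rho> / (2 * lo))) * S"
    using nonneg by (intro mult_right_mono)
  also have "\<dots> \<le> D + n * (2 * h2 * \<epsilon>) + (h2\<^sup>2 + 3 * h1 * h2) * (hi * \<sigma>\<^sup>2) * T"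
    using descent by (simp add: \<epsilon>_def)
  also have "\<dots> \<le> D + n * (1 / q * \<epsilon>) + 3 * (1 / q)\<^sup>2 * (hi * \<sigma>\<^sup>2) * T"
  proof (intro add_mono mult_left_mono mult_right_mono order_refl)
    show "2 * h2 \<le> 1 / q"
      using h2q q by (simp add: field_simps)
    \<comment> \<open>In units of \<open>h1\<^sup>2\<close> the two noise terms add up to at most
      1/4 + 3/2, which is below 3.\<close>
    have "h2\<^sup>2 \<le> (h1 / 2)\<^sup>2"
      using h2 by (intro power_mono) auto
    then have "h2\<^sup>2 \<le> h1\<^sup>2 / 4"
      by (simp add: power_divide)
    moreover have "h1 * h2 \<le> h1\<^sup>2 / 2"
      using mult_left_mono[OF h2(3), of h1] h1pos by (simp add: power2_eq_square)
    ultimately have "h2\<^sup>2 + 3 * (h1 * h2) \<le> 3 * h1\<^sup>2"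
      using zero_le_power2[of h1] by linarith
    then have "h2\<^sup>2 + 3 * h1 * h2 \<le> 3 * h1\<^sup>2"
      by (simp add: mult.assoc)
    also have "\<dots> \<le> 3 * (1 / q)\<^sup>2"
      using h1q h1pos by (intro mult_left_mono power_mono) auto
    finally show "h2\<^sup>2 + 3 * h1 * h2 \<le> 3 * (1 / q)\<^sup>2" .
  qed (use nonneg eps hi in auto)
  finally have cS: "c * S \<le> D + n * (1 / q * \<epsilon>) + 3 * (1 / q)\<^sup>2 * (hi * \<sigma>\<^sup>2) * T" .
  have d3: "d \<le> 2 * (d + 3) ^ 3"
  proof -
    have "d + 3 \<le> (d + 3) ^ 3"
      using nonneg by (intro self_le_power) auto
    then show ?thesis
      using nonneg by linarith
  qed
  \<comment> \<open>One factor \<open>q\<close> turns \<open>(1 / q)\<^sup>2 * hi\<close> into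
    \<open>1 / (L1 * \<kappa>)\<close>, the shape of the noise term in the claim.\<close>
  have "(q * lo * c) * (1 / n * S) = q * lo / n * (c * S)"
    by simp
  also have "\<dots> \<le> q * lo / n * (D + n * (1 / q * \<epsilon>) + 3 * (1 / q)\<^sup>2 * (hi * \<sigma>\<^sup>2) * T)"
    using q lo nonneg cS by (intro mult_left_mono) auto
  also have "\<dots> = q * lo * D / n + lo * \<epsilon> + 3 * lo * \<sigma>\<^sup>2 / (L1 * \<kappa>) * (1 / n * T)"
    using q lo hi L1 kpos nonneg by (simp add: q_def field_simps power2_eq_square)
  also have "\<dots> \<le> 2 * hi * lo * L1 * \<kappa> * D / n + (2 * lo * \<mu>\<^sup>2 * L1 * d + 2 * lo * \<mu>\<^sup>2 * L1\<^sup>2 * \<rho> * (d + 3) ^ 3)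
      + 3 * lo * \<sigma>\<^sup>2 / (L1 * \<kappa>) * (1 / n * T)"
  proof (intro add_mono order_refl)
    have "0 \<le> q * lo * D / n"
      using q lo nonneg by simp
    then have "q * lo * D / n \<le> 2 * (q * lo * D / n)"
      by (simp only: mult_2 le_add_same_cancel1)
    then show "q * lo * D / n \<le> 2 * hi * lo * L1 * \<kappa> * D / n"
      by (simp add: q_def mult_ac)
    have "0 \<le> lo * \<mu>\<^sup>2 * L1 * d"
      using lo L1 nonneg by simp
    moreover have "lo * \<mu>\<^sup>2 * L1\<^sup>2 * \<rho> / 2 * d \<le> lo * \<mu>\<^sup>2 * L1\<^sup>2 * \<rho> * (2 * (d + 3) ^ 3)"
      using lo rho d3 nonneg by (intro mult_mono) auto
    ultimately show "lo * \<epsilon> \<le> 2 * lo * \<mu>\<^sup>2 * L1 * d + 2 * lo * \<mu>\<^sup>2 * L1\<^sup>2 * \<rho> * (d + 3) ^ 3"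
      by (simp add: \<epsilon>_def algebra_simps)
  qed
  finally have "1 / n * S \<le> (2 * hi * lo * L1 * \<kappa> * D / n + (2 * lo * \<mu>\<^sup>2 * L1 * d + 2 * lo * \<mu>\<^sup>2 * L1\<^sup>2 * \<rho> * (d + 3) ^ 3)
      + 3 * lo * \<sigma>\<^sup>2 / (L1 * \<kappa>) * (1 / n * T)) / (q * lo * c)"
    using q lo c by (subst pos_le_divide_eq) (auto simp: mult.commute)
  then show ?thesis
    unfolding E_eq using lo by (simp add: add_divide_distrib mult_ac)
qed

theorem theorem2:
  fixes f :: "(real^'n) \<times> (real^'m) \<Rightarrow> real"
    and B1 :: "real^'n^'n" and B2 :: "real^'m^'m"
    and lmin lmax \<kappa> L1 \<mu> \<sigma> \<rho> h1 h2 :: real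
    and d N :: nat
    and zstar z0 :: "(real^'n) \<times> (real^'m)"
    and M :: "'w measure"
    and t :: "nat \<Rightarrow> nat"
    and uh u :: "nat \<Rightarrow> nat \<Rightarrow> 'w \<Rightarrow> (real^'n) \<times> (real^'m)"
    and z zh :: "nat \<Rightarrow> 'w \<Rightarrow> (real^'n) \<times> (real^'m)"
  assumes d: "d = CARD('n) + CARD('m)"
    and B1: "spd B1" and B2: "spd B2"
    and lmin: "lmin = Min (bdiag_eigenvalues B1 B2)"
    and lmax: "lmax = Max (bdiag_eigenvalues B1 B2)"
    and \<kappa>: "\<kappa> = lmax / lmin"
    and f_diff: "\<And>w. f differentiable (at w)"
    and f_C1: "continuous_on UNIV (grad f)"
    and L1: "L1 > 0"
    and f_Lip: "\<And>w w'. normB_dual B1 B2 (grad f w - grad f w') \<le> L1 * normB B1 B2 (w - w')"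
    and \<mu>: "\<mu> > 0"
    and \<sigma>: "\<sigma> \<ge> 0"
    and variance: "\<And>w. (\<integral>v. (normB_dual B1 B2
           (zo_oracle B1 B2 \<mu> f w v - saddle_op (gsmooth B1 B2 \<mu> f) w))\<^sup>2 \<partial>gaussian B1 B2) \<le> \<sigma>\<^sup>2"
    and \<rho>: "0 \<le> \<rho>" "\<rho> < 1 / (8 * L1 * \<kappa>\<^sup>2)"
    and weak_Minty: "\<And>w. saddle_op f w \<bullet> (w - zstar)
           + \<rho> / 2 * (normB_dual B1 B2 (saddle_op f w))\<^sup>2 \<ge> 0"
    and h1: "0 < h1" "h1 \<le> 1 / (L1 * lmax * \<kappa>)"
    and h2: "0 < h2" "sqrt (2 * \<rho> / (L1 * lmax * lmin * \<kappa>)) < h2" "h2 \<le> h1 / 2"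
    and t: "\<And>k. t k \<ge> 1"
    and M: "prob_space M"
    and sample_indep: "prob_space.indep_vars M (\<lambda>_. borel)
           (\<lambda>(hat, k, i). if hat then uh k i else u k i) {(hat :: bool, k, i). i \<in> {1..t k}}"
    and uh_distr: "\<And>k i. i \<in> {1..t k} \<Longrightarrow> distr M borel (uh k i) = gaussian B1 B2"
    and u_distr: "\<And>k i. i \<in> {1..t k} \<Longrightarrow> distr M borel (u k i) = gaussian B1 B2"
    and z_0: "\<And>\<omega>. \<omega> \<in> space M \<Longrightarrow> z 0 \<omega> = z0"
    and zh_step: "\<And>k \<omega>. \<omega> \<in> space M \<Longrightarrow> zh k \<omega> = z k \<omega> -
           h1 *\<^sub>R ((1 / real (t k)) *\<^sub>R (\<Sum>i=1..t k. zo_oracle B1 B2 \<mu> f (z k \<omega>) (uh k i \<omega>)))"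
    and z_step: "\<And>k \<omega>. \<omega> \<in> space M \<Longrightarrow> z (Suc k) \<omega> = z k \<omega> -
           h2 *\<^sub>R ((1 / real (t k)) *\<^sub>R (\<Sum>i=1..t k. zo_oracle B1 B2 \<mu> f (zh k \<omega>) (u k i \<omega>)))"
  shows "(\<forall>k\<le>N. integrable M (\<lambda>\<omega>. (norm (saddle_op (gsmooth B1 B2 \<mu> f) (zh k \<omega>)))\<^sup>2)) \<and>
    1 / (real N + 1) *
      (\<Sum>k=0..N. \<integral>\<omega>. (norm (saddle_op (gsmooth B1 B2 \<mu> f) (zh k \<omega>)))\<^sup>2 \<partial>M)
    \<le> 2 * lmax * lmin * L1 * \<kappa> * (norm (z0 - zstar))\<^sup>2
          / ((lmax * lmin * L1 * \<kappa> * h2\<^sup>2 - 2 * \<rho>) * (real N + 1))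
      + 2 * lmin * \<mu>\<^sup>2 * L1 * real d / (lmax * lmin * L1 * \<kappa> * h2\<^sup>2 - 2 * \<rho>)
      + 2 * lmin * \<mu>\<^sup>2 * L1\<^sup>2 * \<rho> * (real d + 3) ^ 3 / (lmax * lmin * L1 * \<kappa> * h2\<^sup>2 - 2 * \<rho>)
      + 3 * lmin * \<sigma>\<^sup>2 / (L1 * \<kappa> * (lmax * lmin * L1 * \<kappa> * h2\<^sup>2 - 2 * \<rho>))
          * (1 / (real N + 1) * (\<Sum>k=0..N. 1 / real (t k)))"
proof -
  define B where "B = bdiag B1 B2"
  define A where "A = bdiag (matrix_inv B1) (matrix_inv B2)"
  define Z where "Z = sqrt (det B1 * det B2 / (2 * pi) ^ (CARD('n) + CARD('m)))"
  define S :: "(real^'n) \<times> (real^'m) \<Rightarrow> (real^'n) \<times> (real^'m)" where "S w = (fst w, - snd w)" for w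
  define X where "X = (\<lambda>(hat, k, i). if hat then uh k i else u k i)"
  define I where "I = {(hat :: bool, k, i). i \<in> {1..t k}}"
  let ?\<gamma> = "gaussian B1 B2"
  interpret prob_space M by (rule M)
  have sym: "x \<bullet> B y = B x \<bullet> y" and linear_B: "linear B" for x y
    using bdiag_self_adjoint[OF B1 B2] linear_bdiag by (simp_all add: B_def)
  have eig: "lmin = Min {l. \<exists>v. v \<noteq> 0 \<and> B v = l *\<^sub>R v}" "lmax = Max {l. \<exists>v. v \<noteq> 0 \<and> B v = l *\<^sub>R v}"
    by (simp_all add: lmin lmax bdiag_eigenvalues_def B_def)
  note extremes = eigenvalue_extremes[OF linear_B sym, folded eig]
  \<comment> \<open>The least eigenvalue is attained, so positivity of the form at an eigenvector
    makes it positive.\<close>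
  obtain v where v: "v \<noteq> 0" "B v = lmin *\<^sub>R v"
    using extremes(1) by auto
  have lmin_pos: "0 < lmin"
    using bdiag_pos[OF B1 B2 v(1)] v zero_less_mult_pos2[of lmin "v \<bullet> v"] by (simp add: B_def[symmetric])
  have indep: "indep_vars (\<lambda>_. borel) X I"
    using sample_indep by (simp add: X_def I_def)
  have distr_X: "distr M borel (X i) = ?\<gamma>" if "i \<in> I" for i
    using that uh_distr u_distr by (auto simp: X_def I_def)
  \<comment> \<open>No Gaussian integral is evaluated: the measure is the law of the sample
    \<open>(True, 0, 1)\<close>, which exists because the first batch is nonempty.\<close>
  have prob_gauss: "prob_space ?\<gamma>"
  proof -
    have "(True, 0, 1) \<in> I"
      using t[of 0] by (simp add: I_def)
    moreover from this have "X (True, 0, 1) \<in> borel_measurable M"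
      using indep by (auto simp: indep_vars_def)
    ultimately show ?thesis
      using prob_space_distr distr_X by metis
  qed
  have GDERIV_f: "GDERIV f w :> grad f w" for w
    by (intro differentiable_GDERIV_grad f_diff)
  have linear_S: "linear S"
    by (intro linearI) (simp_all add: S_def)
  interpret smooth_saddle B A lmin lmax Z ?\<gamma> f "grad f" S L1 \<mu>
  proof (intro smooth_saddle.intro gaussian_form.intro smooth_saddle_axioms.intro)
    show "linear A"
      unfolding A_def by (rule linear_bdiag)
    show "A (B x) = x" "B (A x) = x" for x
      using bdiag_inverse[OF B1 B2] by (simp_all add: A_def B_def)
    show "?\<gamma> = density lborel (\<lambda>u. ennreal (Z * exp (- (u \<bullet> B u) / 2)))"
      by (simp add: gaussian_def Z_def B_def)
    show "sqrt ((grad f w - grad f w') \<bullet> A (grad f w - grad f w')) \<le> L1 * sqrt ((w - w') \<bullet> B (w - w'))" for w w'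
      using f_Lip[of w w'] by (simp add: normB_def normB_dual_def A_def B_def)
    show "B (S x) = S (B x)" for x
      by (simp add: B_def S_def bdiag_def linear_neg[OF matrix_vector_mul_linear])
  qed (use linear_B sym lmin_pos extremes prob_gauss GDERIV_f L1 \<mu> linear_S in \<open>auto simp: S_def inner_prod_def\<close>)
  have gsmooth_eq: "gsmooth B1 B2 \<mu> f = smoothed"
    by (simp add: fun_eq_iff gsmooth_def smoothed_def)
  have Fmu_eq: "saddle_op (gsmooth B1 B2 \<mu> f) = F\<mu>"
    by (simp add: fun_eq_iff gsmooth_eq saddle_op_GDERIV[OF smoothed_gderiv] F\<mu>_def S_def)
  have F_eq: "saddle_op f = F"
    by (simp add: fun_eq_iff saddle_op_GDERIV[OF GDERIV_f] F_def S_def)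
  have oracle_eq: "zo_oracle B1 B2 \<mu> f = estimator"
    unfolding zo_oracle_def estimator_def fun_eq_iff by (simp add: S_def B_def bdiag_def)
  have DIM_eq: "DIM((real^'n) \<times> (real^'m)) = d"
    by (simp add: d)
  have dual_sq: "(normB_dual B1 B2 x)\<^sup>2 = x \<bullet> A x" for x
    using A_nonneg[of x] by (simp add: normB_dual_def A_def)
  define \<epsilon> where "\<epsilon> = \<mu>\<^sup>2 * L1 * real d + \<rho> / 2 * (L1\<^sup>2 * \<mu>\<^sup>2 * real d)"
  have "lmin * (v \<bullet> v) \<le> lmax * (v \<bullet> v)"
    by (rule order_trans[OF lo_le le_hi])
  then have "lmin \<le> lmax"
    using v(1) by (simp add: mult_le_cancel_right)
  then have kappa_ge: "1 \<le> \<kappa>"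
    using lmin_pos by (simp add: \<kappa>)
  \<comment> \<open>All parameters are Euclidean now: the Lipschitz constant and the variance each
    pick up a factor \<open>lmax\<close>, and the weight of the Minty term a factor
    \<open>1 / lmin\<close>.\<close>
  interpret stochastic_extragradient M X I ?\<gamma> F\<mu> estimator "L1 * lmax" "lmax * \<sigma>\<^sup>2" t z zh h1 h2
    "\<rho> / (2 * lmin)" \<epsilon> z0 zstar
  proof (intro stochastic_extragradient.intro stochastic_oracle.intro iid_samples.intro
      iid_samples_axioms.intro stochastic_oracle_axioms.intro stochastic_extragradient_axioms.intro)
    show "indep_vars (\<lambda>_. borel) X I"
      by (rule indep)
    show "distr M borel (X i) = ?\<gamma>" if "i \<in> I" for i
      using that by (rule distr_X)
    show "I = {(b, k, i). i \<in> {1..t k}}"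
      by (simp add: I_def)
    show "norm (F\<mu> x - F\<mu> y) \<le> L1 * lmax * norm (x - y)" for x y
      by (rule F\<mu>_lipschitz)
    show "(\<integral>u. (norm (estimator y u - F\<mu> y))\<^sup>2 \<partial>?\<gamma>) \<le> lmax * \<sigma>\<^sup>2" for y
      using variance[of y] by (intro estimator_variance_le) (simp add: dual_sq Fmu_eq oracle_eq)
    \<comment> \<open>The bound on \<open>h1\<close> contains the extra factor
      \<open>\<kappa> \<ge> 1\<close>, so it implies the condition \<open>L * h1 \<le> 1\<close> of
      the descent lemma.\<close>
    have "h1 * (L1 * lmax * \<kappa>) \<le> 1"
      using h1(2) L1 hi_pos kappa_ge by (simp add: le_divide_eq split: if_splits)
    moreover have "h1 * (L1 * lmax) * 1 \<le> h1 * (L1 * lmax) * \<kappa>"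
      using h1(1) L1 hi_pos kappa_ge by (intro mult_left_mono) auto
    ultimately show "L1 * lmax * h1 \<le> 1"
      by (simp add: mult_ac)
    show "0 \<le> F\<mu> w \<bullet> (w - zstar) + \<rho> / (2 * lmin) * (norm (F\<mu> w))\<^sup>2 + \<epsilon>" for w
    proof -
      have "0 \<le> F w \<bullet> (w - zstar) + \<rho> / 2 * (F w \<bullet> A (F w))" for w
        using weak_Minty[of w] by (simp add: F_eq dual_sq)
      from smoothed_minty[OF this \<rho>(1), unfolded DIM_eq]
      have "0 \<le> F\<mu> w \<bullet> (w - zstar) + \<rho> / 2 * (F\<mu> w \<bullet> A (F\<mu> w)) + \<epsilon>"
        by (simp only: \<epsilon>_def)
      moreover have "\<rho> / 2 * (F\<mu> w \<bullet> A (F\<mu> w)) \<le> \<rho> / 2 * ((norm (F\<mu> w))\<^sup>2 / lmin)"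
        using dual_le_norm[of "F\<mu> w"] lmin_pos \<rho>(1)
        by (intro mult_left_mono) (simp_all add: power2_norm_eq_inner le_divide_eq mult.commute)
      ultimately show ?thesis by simp
    qed
    show "zh k \<omega> = z k \<omega> - h1 *\<^sub>R ((1 / real (t k)) *\<^sub>R (\<Sum>i=1..t k. estimator (z k \<omega>) (X (True, k, i) \<omega>)))"
      if "\<omega> \<in> space M" for k \<omega>
      using zh_step[OF that] by (simp add: X_def oracle_eq)
    show "z (Suc k) \<omega> = z k \<omega> - h2 *\<^sub>R ((1 / real (t k)) *\<^sub>R (\<Sum>i=1..t k. estimator (zh k \<omega>) (X (False, k, i) \<omega>)))"
      if "\<omega> \<in> space M" for k \<omega>
      using z_step[OF that] by (simp add: X_def oracle_eq)
  qed (use M prob_gauss t h1(1) h2(1) z_0 measurable_estimator2 integrable_estimator estimator_mean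
      integrable_estimator_sq in auto)
  have "integrable M (\<lambda>\<omega>. (norm (F\<mu> (zh k \<omega>)))\<^sup>2)" for k
    using F_zh_square_integrable[of k] by (simp add: square_integrable_def)
  moreover have "1 / (real N + 1) * (\<Sum>k=0..N. \<integral>\<omega>. (norm (F\<mu> (zh k \<omega>)))\<^sup>2 \<partial>M)
    \<le> 2 * lmax * lmin * L1 * \<kappa> * (norm (z0 - zstar))\<^sup>2
          / ((lmax * lmin * L1 * \<kappa> * h2\<^sup>2 - 2 * \<rho>) * (real N + 1))
      + 2 * lmin * \<mu>\<^sup>2 * L1 * real d / (lmax * lmin * L1 * \<kappa> * h2\<^sup>2 - 2 * \<rho>)
      + 2 * lmin * \<mu>\<^sup>2 * L1\<^sup>2 * \<rho> * (real d + 3) ^ 3 / (lmax * lmin * L1 * \<kappa> * h2\<^sup>2 - 2 * \<rho>)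
      + 3 * lmin * \<sigma>\<^sup>2 / (L1 * \<kappa> * (lmax * lmin * L1 * \<kappa> * h2\<^sup>2 - 2 * \<rho>))
          * (1 / (real N + 1) * (\<Sum>k=0..N. 1 / real (t k)))"
    using sum_expected_le[of N] unfolding \<epsilon>_def
    by (intro rate_from_descent[OF lmin_pos hi_pos \<kappa> L1 \<rho>(1) h1(2) h2])
       (simp_all add: sum_nonneg Bochner_Integration.integral_nonneg)
  ultimately show ?thesis
    unfolding Fmu_eq by blast
qed

end
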